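(* Let $\lambda\in\mathbb{R}$ with $0<|\lambda|<3/8$, and let $g(t,x,\dot x)$ be a real function that is continuous together with its partial derivatives $g_x$ and $g_{\dot x}$ in a neighbourhood of $(0,0,0)$, with $g(0,0,0)\neq0$. Then there exists $\tau>0$ such that the equation $$\ddot x=\lambda\frac{\dot x^2}{x}+g(t,x,\dot x)\quad\text{for a.e. }t$$ has a unique $C^2$-solution on $t\in[-\tau;\tau]$ with the initial condition $x(0)=0$ and the property that $\dot x\ne0$ in a left punctured neighbourhood of $t=0$. This solution satisfies $$\dot x(0)=0\quad\text{and}\quad\ddot x(0)=\frac{g(0,0,0)}{1-2\lambda}.$$ Additionally, if $g$ is analytic, then this solution is analytic.
   Context: A left punctured neighbourhood of $0$ is an interval $(-\delta,0)$ with $\delta>0$. *)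

theory Defs
  imports "HOL-Analysis.Analysis"
begin

text \<open>Derivatives are taken within \<open>S\<close>, hence are one-sided at the end points of a closed interval.\<close>

definition C2_on :: "real set \<Rightarrow> (real \<Rightarrow> real) \<Rightarrow> (real \<Rightarrow> real) \<Rightarrow> (real \<Rightarrow> real) \<Rightarrow> bool" where
  "C2_on S x x' x'' \<longleftrightarrow>
     (\<forall>t\<in>S. (x has_real_derivative x' t) (at t within S)) \<and>
     (\<forall>t\<in>S. (x' has_real_derivative x'' t) (at t within S)) \<and>
     continuous_on S x''"

text \<open>
  The set \<open>U\<close> is the domain of \<open>g\<close>, so the whole curve \<open>(t, x, x')\<close> is required to stay in \<open>U\<close>.
  Since \<open>a / 0 = 0\<close> in HOL, the equation is explicitly required to be meaningful, that is
  \<open>x t \<noteq> 0\<close>, wherever it is required to hold.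
\<close>

definition C2_solution ::
  "real \<Rightarrow> (real \<times> real \<times> real \<Rightarrow> real) \<Rightarrow> (real \<times> real \<times> real) set \<Rightarrow> real \<Rightarrow>
   (real \<Rightarrow> real) \<Rightarrow> (real \<Rightarrow> real) \<Rightarrow> (real \<Rightarrow> real) \<Rightarrow> bool" where
  "C2_solution lam g U \<tau> x x' x'' \<longleftrightarrow>
     C2_on {-\<tau>..\<tau>} x x' x'' \<and>
     (\<forall>t\<in>{-\<tau>..\<tau>}. (t, x t, x' t) \<in> U) \<and>
     (AE t in lebesgue_on {-\<tau>..\<tau>}.
        x t \<noteq> 0 \<and> x'' t = lam * ((x' t)\<^sup>2 / x t) + g (t, x t, x' t))"

definition real_analytic3_on :: "(real \<times> real \<times> real \<Rightarrow> real) \<Rightarrow> (real \<times> real \<times> real) set \<Rightarrow> bool" where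
  "real_analytic3_on g U \<longleftrightarrow>
     (\<forall>(t, x, p)\<in>U. \<exists>c :: nat \<Rightarrow> nat \<Rightarrow> nat \<Rightarrow> real. \<exists>r>0. \<forall>h k l.
        \<bar>h\<bar> < r \<longrightarrow> \<bar>k\<bar> < r \<longrightarrow> \<bar>l\<bar> < r \<longrightarrow>
        ((\<lambda>(i, j, m). c i j m * h ^ i * k ^ j * l ^ m) has_sum g (t + h, x + k, p + l)) UNIV)"

text \<open>
  At an end point of a closed interval \<open>S\<close> the series is compared with \<open>x\<close> on one side only;
  it then has a positive radius of convergence and extends \<open>x\<close> analytically to the other side.
\<close>

definition real_analytic_on :: "(real \<Rightarrow> real) \<Rightarrow> real set \<Rightarrow> bool" where
  "real_analytic_on x S \<longleftrightarrow>
     (\<forall>s\<in>S. \<exists>c :: nat \<Rightarrow> real. \<exists>r>0. \<forall>t\<in>S. \<bar>t - s\<bar> < r \<longrightarrow> (\<lambda>n. c n * (t - s) ^ n) sums x t)"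

end

theory Submission
  imports Defs "HOL-Complex_Analysis.Complex_Analysis"
begin

text \<open>
  Write \<open>w = x''\<close>. Since \<open>x 0 = x' 0 = 0\<close>, Taylor's formula gives \<open>x' t = t * P w t\<close> and
  \<open>x t = t\<^sup>2 * Q w t\<close> with the averages \<open>P w t = \<integral> w (s t) ds\<close> and \<open>Q w t = \<integral> (1 - s) w (s t) ds\<close>
  over \<open>s\<close> in \<open>[0, 1]\<close>, so that the singularity disappears and the equation becomes the fixed point
  problem \<open>w = lam * (P w)\<^sup>2 / Q w + g (t, t\<^sup>2 Q w, t P w)\<close>. On a small ball of continuous functions
  around the constant \<open>a = g (0, 0, 0) / (1 - 2 * lam)\<close> and for small \<open>t\<close>, the right-hand side is a
  contraction. Every solution has \<open>x' 0 = 0\<close> and \<open>x'' 0 = a\<close>, and cannot leave the ball because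
  the fixed point map sends the ball into a strictly smaller one. For analytic \<open>g\<close> the same iteration
  runs on a complex disc, where its iterates are holomorphic and extend the real ones.
\<close>

section \<open>The fixed point problem\<close>

text \<open>The contraction constant shapes the estimates. At \<open>(a, a / 2)\<close> the quotient
  \<open>p^2 / q\<close> has partial derivatives 4 and -4. Bounding the changes of the two averages
  separately would cost \<open>4 * (1 + 1 / 2) = 6\<close>, which is too much unless
  \<open>norm lam < 1 / 6\<close>; keeping their difference together lowers the cost to 2, so that
  \<open>norm lam \<le> 3 / 8\<close> gives at most 3/4 to first order. The remaining quarter pays
  for the nonlinearity of the quotient (raising 3/4 to 7/8), for the Lipschitz dependence of
  \<open>g\<close> (1/16) and for the defect of the constant \<open>a\<close> (1/32), and 31/32 is
  still below 1. The averages run along the segment from 0 to \<open>t\<close> with real weights.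
  Hence the value of the map at \<open>t\<close> depends only on that segment, the map acts on balls
  of every smaller radius, which is what excluding an exit from the ball needs, and it makes sense
  over the reals and over the complex numbers alike. The fixed point theory is therefore done once,
  over an arbitrary complete normed field.\<close>

definition wavg :: "(real \<Rightarrow> real) \<Rightarrow> ('a::{real_normed_field,banach} \<Rightarrow> 'a) \<Rightarrow> 'a \<Rightarrow> 'a" where
  "wavg \<phi> w t = integral {0..1} (\<lambda>s. \<phi> s *\<^sub>R w (s *\<^sub>R t))"

lemma scaleR_in_cball_0:
  fixes t :: "'a::real_normed_vector"
  assumes "norm t \<le> \<tau>" "s \<in> {0..1}"
  shows "norm (s *\<^sub>R t) \<le> \<tau>"
proof -
  have "\<bar>s\<bar> * norm t \<le> 1 * norm t"
    using assms(2) by (intro mult_right_mono) auto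
  then show ?thesis using assms(1) by simp
qed

lemma continuous_on_wavg_integrand:
  fixes w :: "'a::{real_normed_field,banach} \<Rightarrow> 'a"
  assumes "continuous_on {0..1} \<phi>" "continuous_on (cball 0 \<tau>) w" "norm t \<le> \<tau>"
  shows "continuous_on {0..1} (\<lambda>s. \<phi> s *\<^sub>R w (s *\<^sub>R t))"
  by (intro continuous_intros assms(1) continuous_on_compose2[OF assms(2)])
     (use scaleR_in_cball_0[OF assms(3)] in \<open>auto simp: dist_norm\<close>)

lemma wavg_integrable:
  fixes w :: "'a::{real_normed_field,banach} \<Rightarrow> 'a"
  assumes "continuous_on {0..1} \<phi>" "continuous_on (cball 0 \<tau>) w" "norm t \<le> \<tau>"
  shows "(\<lambda>s. \<phi> s *\<^sub>R w (s *\<^sub>R t)) integrable_on {0..1}"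
  by (rule integrable_continuous_interval[OF continuous_on_wavg_integrand[OF assms]])

lemma continuous_on_wavg:
  fixes w :: "'a::{real_normed_field,banach} \<Rightarrow> 'a"
  assumes "continuous_on {0..1} \<phi>" "continuous_on (cball 0 \<tau>) w"
  shows "continuous_on (cball 0 \<tau>) (wavg \<phi> w)"
proof -
  have "continuous_on (cball 0 \<tau> \<times> cbox 0 1) (\<lambda>(t, s). \<phi> s *\<^sub>R w (s *\<^sub>R t))"
    unfolding split_def
    by (intro continuous_intros continuous_on_compose2[OF assms(1)] continuous_on_compose2[OF assms(2)])
       (use scaleR_in_cball_0[where 'a = 'a] in \<open>auto simp del: norm_scaleR\<close>)
  then have "continuous_on (cball 0 \<tau>) (\<lambda>t. integral (cbox 0 1) (\<lambda>s. \<phi> s *\<^sub>R w (s *\<^sub>R t)))"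
    by (rule integral_continuous_on_param)
  then show ?thesis by (simp add: wavg_def[abs_def])
qed

lemma norm_wavg_le:
  fixes w :: "'a::{real_normed_field,banach} \<Rightarrow> 'a"
  assumes \<phi>: "continuous_on {0..1} \<phi>" "\<And>s. s \<in> {0..1} \<Longrightarrow> 0 \<le> \<phi> s" "(\<phi> has_integral m) {0..1}"
    and w: "continuous_on (cball 0 \<tau>) w" "norm t \<le> \<tau>" "\<And>u. norm u \<le> \<tau> \<Longrightarrow> norm (w u) \<le> D"
  shows "norm (wavg \<phi> w t) \<le> m * D"
proof -
  have D: "((\<lambda>s. \<phi> s * D) has_integral m * D) {0..1}"
    by (rule has_integral_mult_left[OF \<phi>(3)])
  have "norm (wavg \<phi> w t) \<le> integral {0..1} (\<lambda>s. \<phi> s * D)"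
    unfolding wavg_def
  proof (rule integral_norm_bound_integral)
    fix s :: real assume s: "s \<in> {0..1}"
    show "norm (\<phi> s *\<^sub>R w (s *\<^sub>R t)) \<le> \<phi> s * D"
      using mult_left_mono[OF w(3)[OF scaleR_in_cball_0[OF w(2) s]] \<phi>(2)[OF s]] \<phi>(2)[OF s] by simp
  qed (use wavg_integrable[OF \<phi>(1) w(1,2)] D in auto)
  then show ?thesis by (simp only: integral_unique[OF D])
qed

lemma wavg_diff:
  fixes v w :: "'a::{real_normed_field,banach} \<Rightarrow> 'a"
  assumes "continuous_on {0..1} \<phi>" "continuous_on (cball 0 \<tau>) v" "continuous_on (cball 0 \<tau>) w"
    "norm t \<le> \<tau>"
  shows "wavg \<phi> (\<lambda>u. v u - w u) t = wavg \<phi> v t - wavg \<phi> w t"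
  unfolding wavg_def
  using integral_diff[OF wavg_integrable[OF assms(1,2,4)] wavg_integrable[OF assms(1,3,4)]]
  by (simp add: scaleR_diff_right)

lemma wavg_diff_weight:
  fixes w :: "'a::{real_normed_field,banach} \<Rightarrow> 'a"
  assumes "continuous_on {0..1} \<phi>" "continuous_on {0..1} \<psi>" "continuous_on (cball 0 \<tau>) w" "norm t \<le> \<tau>"
  shows "wavg (\<lambda>s. \<phi> s - \<psi> s) w t = wavg \<phi> w t - wavg \<psi> w t"
  unfolding wavg_def
  using integral_diff[OF wavg_integrable[OF assms(1,3,4)] wavg_integrable[OF assms(2,3,4)]]
  by (simp add: scaleR_diff_left)

lemma wavg_const:
  assumes "(\<phi> has_integral m) {0..1}"
  shows "wavg \<phi> (\<lambda>_. c) t = m *\<^sub>R c"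
  unfolding wavg_def
  using has_integral_linear[OF assms bounded_linear_scaleR_left, of c]
  by (simp add: comp_def integral_unique)

lemma wavg_cong:
  assumes "norm t \<le> \<tau>" "\<And>u. norm u \<le> \<tau> \<Longrightarrow> v u = w u"
  shows "wavg \<phi> v t = wavg \<phi> w t"
  unfolding wavg_def
  by (intro Henstock_Kurzweil_Integration.integral_cong arg_cong2[of _ _ _ _ scaleR] refl
      assms(2) scaleR_in_cball_0[OF assms(1)])

text \<open>The exact secant identity is \<open>A * (p1 - p2) - B * (q1 - q2)\<close>, where both
  slopes equal 4 at \<open>(a, a / 2)\<close>. Splitting off 4 from each keeps the difference
  \<open>(p1 - p2) - (q1 - q2)\<close> intact; the deviations of the slopes are small because
  \<open>p - 2 * q\<close> vanishes at the centre.\<close>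

lemma norm_square_quotient_diff_le:
  fixes a p1 p2 q1 q2 :: "'a::real_normed_field"
  assumes a: "a \<noteq> 0"
    and p: "norm (p1 - a) \<le> norm a / 100" "norm (p2 - a) \<le> norm a / 100"
    and q: "norm (q1 - a / 2) \<le> norm a / 200" "norm (q2 - a / 2) \<le> norm a / 200"
  shows "norm (p1\<^sup>2 / q1 - p2\<^sup>2 / q2)
       \<le> 4 * norm ((p1 - p2) - (q1 - q2)) + 2 / 9 * norm (p1 - p2) + 2 / 9 * norm (q1 - q2)"
proof -
  define N where "N = norm a"
  have N: "N > 0" using a by (simp add: N_def)
  have lower: "norm q \<ge> 99 / 200 * N" and upper: "norm q \<le> 101 / 200 * N" and "q \<noteq> 0"
    if "norm (q - a / 2) \<le> norm a / 200" for q :: 'a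
  proof -
    have h: "norm (a / 2) = N / 2" by (simp add: N_def norm_divide)
    show "norm q \<ge> 99 / 200 * N"
      using norm_triangle_ineq2[of "a / 2" q] that h by (simp add: N_def norm_minus_commute)
    then show "q \<noteq> 0" using N by auto
    show "norm q \<le> 101 / 200 * N"
      using norm_triangle_ineq2[of q "a / 2"] that h by (simp add: N_def)
  qed
  note q1 = lower[OF q(1)] upper[OF q(1)] \<open>norm (q1 - a / 2) \<le> norm a / 200 \<Longrightarrow> q1 \<noteq> 0\<close>[OF q(1)]
  note q2 = lower[OF q(2)] upper[OF q(2)] \<open>norm (q2 - a / 2) \<le> norm a / 200 \<Longrightarrow> q2 \<noteq> 0\<close>[OF q(2)]
  have pq: "norm (p - 2 * q) \<le> N / 50"
    if "norm (p - a) \<le> norm a / 100" "norm (q - a / 2) \<le> norm a / 200" for p q :: 'a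
  proof -
    have "p - 2 * q = (p - a) - 2 * (q - a / 2)" by (simp add: algebra_simps)
    then have "norm (p - 2 * q) \<le> norm (p - a) + norm (2 * (q - a / 2))"
      by (simp only: norm_triangle_ineq4)
    also have "norm (2 * (q - a / 2)) = 2 * norm (q - a / 2)"
      by (simp only: norm_mult norm_numeral)
    finally show ?thesis using that by (simp add: N_def)
  qed
  have p2: "norm p2 \<le> 101 / 100 * N"
    using norm_triangle_ineq2[of p2 a] p(2) by (simp add: N_def)
  define A where "A = (p1 + p2) / q1"
  define B where "B = p2\<^sup>2 / (q1 * q2)"
  have eq: "p1\<^sup>2 / q1 - p2\<^sup>2 / q2 = 4 * ((p1 - p2) - (q1 - q2)) + (A - 4) * (p1 - p2) - (B - 4) * (q1 - q2)"
    unfolding A_def B_def using q1(3) q2(3) by (simp add: field_simps power2_eq_square)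
  have A: "norm (A - 4) \<le> 2 / 9"
  proof -
    have "A - 4 = ((p1 - 2 * q1) + (p2 - 2 * q1)) / q1"
      unfolding A_def using q1(3) by (simp add: field_simps)
    moreover have "norm ((p1 - 2 * q1) + (p2 - 2 * q1)) \<le> N / 25"
      using norm_triangle_ineq[of "p1 - 2 * q1" "p2 - 2 * q1"] pq[OF p(1) q(1)] pq[OF p(2) q(1)] by simp
    ultimately have "norm (A - 4) \<le> (N / 25) / (99 / 200 * N)"
      using q1(1) N by (simp only: norm_divide) (intro frac_le, auto)
    also have "\<dots> \<le> 2 / 9" using N by simp
    finally show ?thesis .
  qed
  have B: "norm (B - 4) \<le> 2 / 9"
  proof -
    \<comment> \<open>The numerator \<open>p2^2 - 4 * q1 * q2\<close> is rewritten so that each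
      summand contains a small factor \<open>p - 2 * q\<close>.\<close>
    have "B - 4 = ((p2 - 2 * q1) * p2 + 2 * q1 * (p2 - 2 * q2)) / (q1 * q2)"
      unfolding B_def using q1(3) q2(3) by (simp add: field_simps power2_eq_square)
    moreover have "norm ((p2 - 2 * q1) * p2 + 2 * q1 * (p2 - 2 * q2))
        \<le> (N / 50) * (101 / 100 * N) + (2 * (101 / 200 * N)) * (N / 50)"
    proof (rule norm_triangle_mono)
      show "norm ((p2 - 2 * q1) * p2) \<le> (N / 50) * (101 / 100 * N)"
        unfolding norm_mult using pq[OF p(2) q(1)] p2 N by (intro mult_mono) auto
      show "norm (2 * q1 * (p2 - 2 * q2)) \<le> (2 * (101 / 200 * N)) * (N / 50)"
        unfolding norm_mult norm_numeral using pq[OF p(2) q(2)] q1(2) N by (intro mult_mono) auto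
    qed
    moreover have "norm (q1 * q2) \<ge> (99 / 200 * N) * (99 / 200 * N)"
      using mult_mono[OF q1(1) q2(1)] N by (simp add: norm_mult)
    ultimately have "norm (B - 4) \<le> ((N / 50) * (101 / 100 * N) + (2 * (101 / 200 * N)) * (N / 50)) 
        / ((99 / 200 * N) * (99 / 200 * N))"
      using N by (simp only: norm_divide) (intro frac_le, auto)
    also have "\<dots> \<le> 2 / 9" using N by (simp add: field_simps)
    finally show ?thesis .
  qed
  have "norm (p1\<^sup>2 / q1 - p2\<^sup>2 / q2) 
      \<le> norm (4 * ((p1 - p2) - (q1 - q2))) + norm ((A - 4) * (p1 - p2)) + norm ((B - 4) * (q1 - q2))"
    unfolding eq by (meson add_right_mono norm_triangle_ineq norm_triangle_ineq4 order_trans)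
  also have "norm (4 * ((p1 - p2) - (q1 - q2))) = 4 * norm ((p1 - p2) - (q1 - q2))"
    by (simp only: norm_mult norm_numeral)
  finally show ?thesis
    using mult_right_mono[OF A, of "norm (p1 - p2)"] mult_right_mono[OF B, of "norm (q1 - q2)"]
    by (simp add: norm_mult)
qed

section \<open>The fixed point map and its contraction property\<close>

abbreviation mean1 :: "('a::{real_normed_field,banach} \<Rightarrow> 'a) \<Rightarrow> 'a \<Rightarrow> 'a" where
  "mean1 \<equiv> wavg (\<lambda>_. 1)"

abbreviation mean2 :: "('a::{real_normed_field,banach} \<Rightarrow> 'a) \<Rightarrow> 'a \<Rightarrow> 'a" where
  "mean2 \<equiv> wavg (\<lambda>s. 1 - s)"

lemma weight_integrals:
  "((\<lambda>_. 1 :: real) has_integral 1) {0..1::real}"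
  "((\<lambda>s. s) has_integral 1 / 2) {0..1::real}"
  "((\<lambda>s. 1 - s) has_integral 1 / 2) {0..1::real}"
proof -
  show 1: "((\<lambda>_. 1 :: real) has_integral 1) {0..1::real}"
    using has_integral_const_real[of "1::real" 0 1] by simp
  show 2: "((\<lambda>s. s) has_integral 1 / 2) {0..1::real}"
    using ident_has_integral[of 0 "1::real"] by simp
  show "((\<lambda>s. 1 - s) has_integral 1 / 2) {0..1::real}"
    using has_integral_diff[OF 1 2] by simp
qed

text \<open>The bound on \<open>r\<close> is what the quotient estimate asks for;
  \<open>\<tau> * (norm a + r) \<le> \<rho>\<close> keeps the curve in the box where
  \<open>G\<close> is controlled, and \<open>\<tau> \<le> 1\<close> lets \<open>t^2\<close> be
  estimated by \<open>\<tau>\<close>. The constants 1/16 and 1/32 are the shares of \<open>G\<close>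
  and of the initial defect in the contraction budget.\<close>

locale singular_ode =
  fixes lam a :: "'a::{real_normed_field,banach}"
    and G :: "'a \<times> 'a \<times> 'a \<Rightarrow> 'a"
    and r \<tau> \<rho> L :: real
  assumes lam: "norm lam \<le> 3 / 8"
    and a: "a \<noteq> 0"
    and r: "0 < r" "r \<le> norm a / 100"
    and \<tau>: "0 < \<tau>" "\<tau> \<le> 1" "\<tau> \<le> \<rho>" "\<tau> * (norm a + r) \<le> \<rho>"
    and G_cont: "continuous_on (cball 0 \<rho> \<times> cball 0 \<rho> \<times> cball 0 \<rho>) G"
    and L: "0 \<le> L" "L * (2 * \<tau>) \<le> 1 / 16"
    and G_lipschitz: "\<And>t x p y q. \<lbrakk>norm t \<le> \<rho>; norm x \<le> \<rho>; norm p \<le> \<rho>; norm y \<le> \<rho>; norm q \<le> \<rho>\<rbrakk>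
      \<Longrightarrow> norm (G (t, x, p) - G (t, y, q)) \<le> L * (norm (x - y) + norm (p - q))"
    and G_init: "\<And>t. norm t \<le> \<tau> \<Longrightarrow> norm (G (t, t\<^sup>2 * (a / 2), t * a) - (1 - 2 * lam) * a) \<le> r / 32"
begin

definition F :: "('a \<Rightarrow> 'a) \<Rightarrow> 'a \<Rightarrow> 'a" where
  "F w t = lam * ((mean1 w t)\<^sup>2 / mean2 w t) + G (t, t\<^sup>2 * mean2 w t, t * mean1 w t)"

text \<open>The radius \<open>s\<close> is a parameter, not fixed to \<open>\<tau>\<close>, because
  a given solution is first known to be close to \<open>a\<close> on a smaller ball only.\<close>

definition near :: "real \<Rightarrow> ('a \<Rightarrow> 'a) \<Rightarrow> bool" where
  "near s w \<longleftrightarrow> continuous_on (cball 0 s) w \<and> (\<forall>t. norm t \<le> s \<longrightarrow> norm (w t - a) \<le> r)"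

lemma near_const: "near s (\<lambda>_. a)"
  using r by (simp add: near_def)

lemma near_means:
  assumes w: "near s w" and t: "norm t \<le> s"
  shows "norm (mean1 w t - a) \<le> r" "norm (mean2 w t - a / 2) \<le> r / 2"
proof -
  have c: "continuous_on (cball 0 s) w" "continuous_on (cball 0 s) (\<lambda>t. w t - a)"
    using w by (auto simp: near_def intro!: continuous_intros)
  have wa: "norm (w u - a) \<le> r" if "norm u \<le> s" for u using w that by (simp add: near_def)
  have "mean1 (\<lambda>t. w t - a) t = mean1 w t - a"
    using wavg_diff[OF _ c(1) continuous_on_const t, of "\<lambda>_. 1" a] 
    by (simp add: wavg_const[OF weight_integrals(1)])
  then show "norm (mean1 w t - a) \<le> r"
    using norm_wavg_le[OF _ _ weight_integrals(1) c(2) t wa] by simp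
  have "mean2 (\<lambda>t. w t - a) t = mean2 w t - a / 2"
    using wavg_diff[OF _ c(1) continuous_on_const t, of "\<lambda>s. 1 - s" a] 
    by (simp add: wavg_const[OF weight_integrals(3)] continuous_intros scaleR_conv_of_real)
  moreover have "norm (mean2 (\<lambda>t. w t - a) t) \<le> 1 / 2 * r"
    by (rule norm_wavg_le[OF _ _ weight_integrals(3) c(2) t wa]) (auto intro!: continuous_intros)
  ultimately show "norm (mean2 w t - a / 2) \<le> r / 2" by simp
qed

lemma near_mean2_nonzero:
  assumes "near s w" "norm t \<le> s"
  shows "mean2 w t \<noteq> 0"
proof
  assume "mean2 w t = 0"
  then have "norm a / 2 \<le> r / 2"
    using near_means(2)[OF assms] by (simp add: norm_divide)
  then show False using r a by simp
qed

lemma near_box: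
  assumes w: "near s w" and t: "norm t \<le> s" "s \<le> \<tau>"
  shows "norm t \<le> \<rho>" "norm (t\<^sup>2 * mean2 w t) \<le> \<rho>" "norm (t * mean1 w t) \<le> \<rho>"
proof -
  have t': "norm t \<le> \<tau>" "norm t \<le> 1" using t \<tau> by auto
  show "norm t \<le> \<rho>" using t' \<tau> by simp
  have m1: "norm (mean1 w t) \<le> norm a + r"
    using norm_triangle_ineq2[of "mean1 w t" a] near_means(1)[OF w t(1)] by simp
  have m2: "norm (mean2 w t) \<le> norm a + r"
    using norm_triangle_ineq2[of "mean2 w t" "a / 2"] near_means(2)[OF w t(1)] r
    by (simp add: norm_divide)
  have "norm (t * mean1 w t) \<le> \<tau> * (norm a + r)"
    unfolding norm_mult using t' m1 \<tau> by (intro mult_mono) auto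
  then show "norm (t * mean1 w t) \<le> \<rho>" using \<tau>(4) by simp
  have "(norm t)\<^sup>2 \<le> \<tau> * 1"
    unfolding power2_eq_square using t' \<tau> by (intro mult_mono) auto
  then have "norm (t\<^sup>2 * mean2 w t) \<le> \<tau> * (norm a + r)"
    unfolding norm_mult norm_power using m2 \<tau> by (intro mult_mono) auto
  then show "norm (t\<^sup>2 * mean2 w t) \<le> \<rho>" using \<tau>(4) by simp
qed

text \<open>To first order at the constant \<open>a\<close>, the quotient changes by four times \<open>mean1 d - mean2 d\<close>,
  which is the average of \<open>d\<close> against the weight \<open>s\<close> of mass \<open>1/2\<close>; hence the factor
  \<open>2 * norm lam < 1\<close>.\<close>

lemma F_contraction:
  assumes v: "near s v" and w: "near s w" and t: "norm t \<le> s" "s \<le> \<tau>"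
    and D: "\<And>u. norm u \<le> s \<Longrightarrow> norm (v u - w u) \<le> D"
  shows "norm (F v t - F w t) \<le> 15 / 16 * D"
proof -
  have c: "continuous_on (cball 0 s) v" "continuous_on (cball 0 s) w"
      "continuous_on (cball 0 s) (\<lambda>u. v u - w u)"
    using v w by (auto simp: near_def intro!: continuous_intros)
  have D0: "0 \<le> D" using D[OF t(1)] norm_ge_zero order_trans by blast
  let ?d = "\<lambda>u. v u - w u"
  have e1: "mean1 v t - mean1 w t = mean1 ?d t"
    using wavg_diff[OF _ c(1,2) t(1), of "\<lambda>_. 1"] by simp
  have e2: "mean2 v t - mean2 w t = mean2 ?d t"
    using wavg_diff[OF _ c(1,2) t(1), of "\<lambda>s. 1 - s"] by (simp add: continuous_intros)
  have e3: "mean1 ?d t - mean2 ?d t = wavg (\<lambda>s. s) ?d t"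
    using wavg_diff_weight[OF _ _ c(3) t(1), of "\<lambda>_. 1" "\<lambda>s. 1 - s"] by (simp add: continuous_intros)
  have n1: "norm (mean1 v t - mean1 w t) \<le> D"
    unfolding e1 using norm_wavg_le[OF _ _ weight_integrals(1) c(3) t(1) D] by simp
  have "norm (mean2 ?d t) \<le> 1 / 2 * D"
    by (rule norm_wavg_le[OF _ _ weight_integrals(3) c(3) t(1) D]) (auto intro!: continuous_intros)
  then have n2: "norm (mean2 v t - mean2 w t) \<le> D / 2" unfolding e2 by simp
  have "norm (wavg (\<lambda>s. s) ?d t) \<le> 1 / 2 * D"
    by (rule norm_wavg_le[OF _ _ weight_integrals(2) c(3) t(1) D]) (auto intro!: continuous_intros)
  then have n3: "norm ((mean1 v t - mean1 w t) - (mean2 v t - mean2 w t)) \<le> D / 2"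
    unfolding e1 e2 e3 by simp
  have "norm ((mean1 v t)\<^sup>2 / mean2 v t - (mean1 w t)\<^sup>2 / mean2 w t) \<le> 
      4 * norm ((mean1 v t - mean1 w t) - (mean2 v t - mean2 w t))
      + 2 / 9 * norm (mean1 v t - mean1 w t) + 2 / 9 * norm (mean2 v t - mean2 w t)"
    using near_means[OF v t(1)] near_means[OF w t(1)] r a
    by (intro norm_square_quotient_diff_le[of a]) auto
  \<comment> \<open>The three terms contribute \<open>4 * (1 / 2)\<close>, \<open>2 / 9\<close> and
    \<open>(2 / 9) * (1 / 2)\<close>. Multiplied by 3/8 the sum gives 7/8, which leaves 1/16 for
    \<open>G\<close> below the target 15/16.\<close>
  also have "\<dots> \<le> 7 / 3 * D" using n1 n2 n3 by simp
  finally have quot: "norm (lam * ((mean1 v t)\<^sup>2 / mean2 v t - (mean1 w t)\<^sup>2 / mean2 w t)) \<le> 3 / 8 * (7 / 3 * D)"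
    unfolding norm_mult using lam D0 by (intro mult_mono) auto
  have t': "norm t \<le> \<tau>" "norm t \<le> 1" using t \<tau> by auto
  have "norm (G (t, t\<^sup>2 * mean2 v t, t * mean1 v t) - G (t, t\<^sup>2 * mean2 w t, t * mean1 w t))
      \<le> L * (norm (t\<^sup>2 * mean2 v t - t\<^sup>2 * mean2 w t) + norm (t * mean1 v t - t * mean1 w t))"
    using near_box[OF v t] near_box[OF w t] by (intro G_lipschitz) auto
  also have "\<dots> \<le> L * (\<tau> * D + \<tau> * D)"
  proof (intro mult_left_mono add_mono L)
    have "(norm t)\<^sup>2 \<le> \<tau> * 1"
      unfolding power2_eq_square using t' \<tau> by (intro mult_mono) auto
    then have "(norm t)\<^sup>2 * norm (mean2 v t - mean2 w t) \<le> \<tau> * D"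
      using n2 D0 \<tau> by (intro mult_mono) auto
    then show "norm (t\<^sup>2 * mean2 v t - t\<^sup>2 * mean2 w t) \<le> \<tau> * D"
      by (simp add: right_diff_distrib[symmetric] norm_mult norm_power)
    have "norm t * norm (mean1 v t - mean1 w t) \<le> \<tau> * D"
      using n1 D0 t' \<tau> by (intro mult_mono) auto
    then show "norm (t * mean1 v t - t * mean1 w t) \<le> \<tau> * D"
      by (simp add: right_diff_distrib[symmetric] norm_mult)
  qed
  also have "\<dots> = (L * (2 * \<tau>)) * D" by (simp add: algebra_simps)
  also have "\<dots> \<le> 1 / 16 * D" using L D0 by (intro mult_right_mono) auto
  finally have Gd: "norm (G (t, t\<^sup>2 * mean2 v t, t * mean1 v t) - G (t, t\<^sup>2 * mean2 w t, t * mean1 w t)) \<le> 1 / 16 * D" .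
  have "F v t - F w t = lam * ((mean1 v t)\<^sup>2 / mean2 v t - (mean1 w t)\<^sup>2 / mean2 w t)
     + (G (t, t\<^sup>2 * mean2 v t, t * mean1 v t) - G (t, t\<^sup>2 * mean2 w t, t * mean1 w t))"
    by (simp add: F_def algebra_simps)
  then show ?thesis
    using norm_triangle_ineq[of "lam * ((mean1 v t)\<^sup>2 / mean2 v t - (mean1 w t)\<^sup>2 / mean2 w t)"
        "G (t, t\<^sup>2 * mean2 v t, t * mean1 v t) - G (t, t\<^sup>2 * mean2 w t, t * mean1 w t)"] quot Gd
    by simp
qed

text \<open>The contraction towards the image of the constant \<open>a\<close> costs
  \<open>15 / 16 * r\<close>, and that image misses \<open>a\<close> by at most
  \<open>r / 32\<close>. The strict gain over \<open>r\<close> later prevents solutions from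
  reaching the boundary of the ball.\<close>

lemma norm_F_diff_a:
  assumes w: "near s w" and t: "norm t \<le> s" "s \<le> \<tau>"
  shows "norm (F w t - a) \<le> 31 / 32 * r"
proof -
  have "F (\<lambda>_. a) t = lam * (a\<^sup>2 / (a / 2)) + G (t, t\<^sup>2 * (a / 2), t * a)"
    by (simp add: F_def wavg_const[OF weight_integrals(1)] wavg_const[OF weight_integrals(3)] scaleR_conv_of_real)
  also have "a\<^sup>2 / (a / 2) = 2 * a" using a by (simp add: field_simps power2_eq_square)
  finally have "F (\<lambda>_. a) t - a = G (t, t\<^sup>2 * (a / 2), t * a) - (1 - 2 * lam) * a"
    by (simp add: algebra_simps)
  then have "norm (F (\<lambda>_. a) t - a) \<le> r / 32" using G_init[of t] t by simp
  moreover have "norm (F w t - F (\<lambda>_. a) t) \<le> 15 / 16 * r"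
    using w by (intro F_contraction[OF w near_const t]) (auto simp: near_def)
  ultimately show ?thesis
    using norm_triangle_ineq[of "F w t - F (\<lambda>_. a) t" "F (\<lambda>_. a) t - a"] by simp
qed

lemma continuous_on_F:
  assumes w: "near s w" and s: "s \<le> \<tau>"
  shows "continuous_on (cball 0 s) (F w)"
proof -
  have c: "continuous_on (cball 0 s) w" using w by (simp add: near_def)
  have 1: "continuous_on (cball 0 s) (mean1 w)" "continuous_on (cball 0 s) (mean2 w)"
    by (intro continuous_on_wavg c continuous_intros)+
  have "continuous_on (cball 0 s) (\<lambda>t. G (t, t\<^sup>2 * mean2 w t, t * mean1 w t))"
    by (rule continuous_on_compose2[OF G_cont])
       (use near_box[OF w _ s] in \<open>auto intro!: continuous_intros 1\<close>)
  then show ?thesis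
    unfolding F_def[abs_def] using near_mean2_nonzero[OF w] by (intro continuous_intros 1) auto
qed

lemma near_F:
  assumes "near s w" "s \<le> \<tau>"
  shows "near s (F w)"
  using continuous_on_F[OF assms] norm_F_diff_a[OF assms(1) _ assms(2)] r
  unfolding near_def by fastforce

text \<open>Both functions start within \<open>2 * r\<close> of each other, and each application of
  \<open>F\<close> improves a uniform bound by 15/16; since both are fixed, the bound applies to the
  functions themselves for every \<open>n\<close>.\<close>

lemma fixed_point_unique:
  assumes v: "near s v" and w: "near s w" and s: "s \<le> \<tau>"
    and fv: "\<And>t. norm t \<le> s \<Longrightarrow> F v t = v t" and fw: "\<And>t. norm t \<le> s \<Longrightarrow> F w t = w t"
    and t: "norm t \<le> s"
  shows "v t = w t"
proof -
  have bound: "norm (v u - w u) \<le> (15 / 16) ^ n * (2 * r)" if "norm u \<le> s" for n u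
    using that
  proof (induction n arbitrary: u)
    case 0
    then show ?case
      using v w norm_triangle_ineq4[of "v u - a" "w u - a"] unfolding near_def by fastforce
  next
    case (Suc n)
    then show ?case
      using F_contraction[OF v w Suc.prems s Suc.IH] fv[OF Suc.prems] fw[OF Suc.prems] by simp
  qed
  have "(\<lambda>n. (15 / 16) ^ n * (2 * r)) \<longlonglongrightarrow> 0"
    by (intro tendsto_mult_left_zero LIMSEQ_power_zero) simp
  then have "norm (v t - w t) \<le> 0"
    using bound[OF t] by (intro LIMSEQ_le_const) auto
  then show ?thesis by simp
qed

section \<open>Picard iteration\<close>

definition iter :: "nat \<Rightarrow> 'a \<Rightarrow> 'a" where
  "iter n = (F ^^ n) (\<lambda>_. a)"

text \<open>As a pointwise limit of iterates this depends on \<open>lam\<close>, \<open>a\<close>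
  and \<open>G\<close> only, not on \<open>\<tau>\<close>: shrinking the ball does not change the
  function. The analytic case relies on this.\<close>

definition sol :: "'a \<Rightarrow> 'a" where
  "sol t = lim (\<lambda>n. iter n t)"

lemma near_iter: "near \<tau> (iter n)"
  by (induction n) (simp_all add: iter_def near_const near_F)

lemma iter_step:
  assumes "norm t \<le> \<tau>"
  shows "norm (iter (Suc n) t - iter n t) \<le> (15 / 16) ^ n * r"
  using assms
proof (induction n arbitrary: t)
  case 0
  then show ?case using near_iter[of 1] by (simp add: near_def iter_def)
next
  case (Suc n)
  have "norm (F (iter (Suc n)) t - F (iter n) t) \<le> 15 / 16 * ((15 / 16) ^ n * r)"
    by (rule F_contraction[OF near_iter near_iter Suc.prems order_refl Suc.IH])
  then show ?case by (simp add: iter_def)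
qed

text \<open>The iterates are the partial sums of a telescoping series whose terms decay
  geometrically and uniformly on the ball, so the M-test applies.\<close>

lemma iter_uniform_limit: "uniform_limit (cball 0 \<tau>) iter sol sequentially"
proof -
  have "uniform_limit (cball 0 \<tau>) (\<lambda>n t. \<Sum>i<n. iter (Suc i) t - iter i t)
      (\<lambda>t. \<Sum>i. iter (Suc i) t - iter i t) sequentially"
    by (rule Weierstrass_m_test[where M = "\<lambda>n. (15 / 16) ^ n * r"])
       (use iter_step in \<open>auto intro!: summable_mult2 summable_geometric\<close>)
  then have "uniform_limit (cball 0 \<tau>) (\<lambda>n t. a + (\<Sum>i<n. iter (Suc i) t - iter i t))
      (\<lambda>t. a + (\<Sum>i. iter (Suc i) t - iter i t)) sequentially"
    by (intro uniform_limit_intros)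
  moreover have "a + (\<Sum>i<n. iter (Suc i) t - iter i t) = iter n t" for n t
    using sum_lessThan_telescope[of "\<lambda>i. iter i t" n] by (simp add: iter_def)
  ultimately have u: "uniform_limit (cball 0 \<tau>) iter (\<lambda>t. a + (\<Sum>i. iter (Suc i) t - iter i t)) sequentially"
    by simp
  moreover have "a + (\<Sum>i. iter (Suc i) t - iter i t) = sol t" if "t \<in> cball 0 \<tau>" for t
    using tendsto_uniform_limitI[OF u that] by (simp add: sol_def limI)
  ultimately show ?thesis
    by (metis (no_types, lifting) uniform_limit_cong')
qed

lemma near_sol: "near \<tau> sol"
proof -
  have "continuous_on (cball 0 \<tau>) sol"
    by (rule uniform_limit_theorem[OF _ iter_uniform_limit]) (use near_iter in \<open>auto simp: near_def\<close>)
  moreover have "norm (sol t - a) \<le> r" if t: "norm t \<le> \<tau>" for t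
  proof (rule LIMSEQ_le_const2)
    show "(\<lambda>n. norm (iter n t - a)) \<longlonglongrightarrow> norm (sol t - a)"
      by (intro tendsto_intros tendsto_uniform_limitI[OF iter_uniform_limit]) (use t in auto)
    show "\<exists>N. \<forall>n\<ge>N. norm (iter n t - a) \<le> r" using near_iter t by (auto simp: near_def)
  qed
  ultimately show ?thesis by (simp add: near_def)
qed

lemma F_sol:
  assumes t: "norm t \<le> \<tau>"
  shows "F sol t = sol t"
proof -
  \<comment> \<open>The contraction estimate itself gives continuity of \<open>F\<close> along the
    uniformly convergent iterates.\<close>
  have "(\<lambda>n. F (iter n) t) \<longlonglongrightarrow> F sol t"
  proof (rule LIMSEQ_I)
    fix e :: real assume e: "0 < e"
    have "eventually (\<lambda>n. \<forall>u\<in>cball 0 \<tau>. dist (iter n u) (sol u) < e) sequentially"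
      using uniform_limitD[OF iter_uniform_limit e] .
    then obtain N where N: "\<And>n u. n \<ge> N \<Longrightarrow> u \<in> cball 0 \<tau> \<Longrightarrow> dist (iter n u) (sol u) < e"
      unfolding eventually_sequentially by blast
    have "norm (F (iter n) t - F sol t) < e" if n: "n \<ge> N" for n
    proof -
      have "norm (F (iter n) t - F sol t) \<le> 15 / 16 * e"
        by (rule F_contraction[OF near_iter near_sol t]) (use N[OF n] in \<open>auto simp: dist_norm less_imp_le\<close>)
      then show ?thesis using e by simp
    qed
    then show "\<exists>N. \<forall>n\<ge>N. norm (F (iter n) t - F sol t) < e" by blast
  qed
  moreover have "(\<lambda>n. F (iter n) t) = (\<lambda>n. iter (Suc n) t)" by (simp add: iter_def)
  moreover have "(\<lambda>n. iter (Suc n) t) \<longlonglongrightarrow> sol t"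
    using LIMSEQ_Suc[OF tendsto_uniform_limitI[OF iter_uniform_limit, of t]] t by simp
  ultimately show ?thesis using LIMSEQ_unique by metis
qed

end

section \<open>Solutions of the real equation\<close>

text \<open>A nondegenerate interval around \<open>t0\<close>, clipped to \<open>{a..b}\<close>, has
  positive measure and so meets every set of full measure. The radius \<open>e / 2\<close> keeps its
  closed end points strictly within distance \<open>e\<close>.\<close>

lemma AE_lebesgue_on_atLeastAtMost_dense:
  assumes ae: "AE t in lebesgue_on {a..b::real}. P t" and ab: "a < b" and t0: "t0 \<in> {a..b}" and e: "0 < e"
  obtains t where "t \<in> {a..b}" "\<bar>t - t0\<bar> < e" "P t"
proof -
  define c where "c = max a (t0 - e / 2)"
  define d where "d = min b (t0 + e / 2)"
  have cd: "c < d" using ab t0 e by (auto simp: c_def d_def)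
  have "\<exists>t\<in>{c..d}. P t"
  proof (rule ccontr)
    assume n: "\<not> (\<exists>t\<in>{c..d}. P t)"
    have "AE t in lebesgue. t \<in> {a..b} \<longrightarrow> P t"
      using ae by (simp add: AE_restrict_space_iff)
    then have "AE t in lebesgue. t \<notin> {c..d}"
      by (rule AE_mp) (use n in \<open>auto intro!: AE_I2 simp: c_def d_def\<close>)
    then have "{c..d} \<in> null_sets lebesgue"
      by (subst AE_iff_null_sets) auto
    then show False using cd by (simp add: null_sets_def)
  qed
  then obtain t where "t \<in> {c..d}" "P t" by blast
  then show ?thesis using that[of t] e by (auto simp: c_def d_def)
qed

lemma C2_onD:
  assumes "C2_on S x x' x''"
  shows "t \<in> S \<Longrightarrow> (x has_real_derivative x' t) (at t within S)"
    "t \<in> S \<Longrightarrow> (x' has_real_derivative x'' t) (at t within S)"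
    "continuous_on S x" "continuous_on S x'" "continuous_on S x''"
  using assms by (auto simp: C2_on_def intro!: DERIV_continuous_on)

lemma C2_solutionD:
  assumes "C2_solution lam g U \<tau> x x' x''"
  shows "C2_on {-\<tau>..\<tau>} x x' x''" "t \<in> {-\<tau>..\<tau>} \<Longrightarrow> (t, x t, x' t) \<in> U"
  using assms by (auto simp: C2_solution_def)

text \<open>Cleared of denominators, the equation extends by continuity from almost every to every point,
  zeros of \<open>x\<close> included.\<close>

lemma C2_solution_everywhere:
  assumes sol: "C2_solution lam g U \<tau> x x' x''" and \<tau>: "0 < \<tau>" and g: "continuous_on U g"
    and t: "t \<in> {-\<tau>..\<tau>}"
  shows "x'' t * x t = lam * (x' t)\<^sup>2 + g (t, x t, x' t) * x t"
proof -
  note c = C2_onD(3-5)[OF C2_solutionD(1)[OF sol]]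
  define h where "h t = x'' t * x t - lam * (x' t)\<^sup>2 - g (t, x t, x' t) * x t" for t
  have h: "continuous_on {-\<tau>..\<tau>} h"
    unfolding h_def[abs_def]
    by (intro continuous_intros c continuous_on_compose2[OF g]) (use C2_solutionD(2)[OF sol] in auto)
  have ae: "AE t in lebesgue_on {-\<tau>..\<tau>}. h t = 0"
    using sol unfolding C2_solution_def
    by (elim conjE, elim AE_mp, intro AE_I2) (auto simp: h_def field_simps)
  have "h t = 0"
  proof (rule ccontr)
    assume "h t \<noteq> 0"
    then obtain e where e: "e > 0" "\<And>s. s \<in> {-\<tau>..\<tau>} \<Longrightarrow> dist s t < e \<Longrightarrow> dist (h s) (h t) < \<bar>h t\<bar>"
      using h t unfolding continuous_on_iff by (metis zero_less_abs_iff)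
    obtain s where "s \<in> {-\<tau>..\<tau>}" "\<bar>s - t\<bar> < e" "h s = 0"
      by (rule AE_lebesgue_on_atLeastAtMost_dense[OF ae _ t e(1)]) (use \<tau> in auto)
    then show False using e(2)[of s] by (simp add: dist_real_def)
  qed
  then show ?thesis by (simp add: h_def)
qed

text \<open>On the left of \<open>0\<close>, where \<open>y\<close> does not vanish, Cauchy's mean value theorem gives
  \<open>(y' t)\<^sup>2 / y t = 2 * y'' \<xi>\<close> with \<open>t < \<xi> < 0\<close>; this also excludes \<open>y'' 0 = 0\<close>.\<close>

lemma C2_solution_initial:
  assumes sol: "C2_solution lam g U \<tau> y y' y''" and \<tau>: "0 < \<tau>" and g: "continuous_on U g"
    and lam: "lam \<noteq> 0" "lam \<noteq> 1 / 2" and y0: "y 0 = 0"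
    and \<delta>: "0 < \<delta>" "\<delta> \<le> \<tau>" "\<And>t. t \<in> {-\<delta><..<0} \<Longrightarrow> y' t \<noteq> 0"
  shows "y' 0 = 0" "y'' 0 = g (0, 0, 0) / (1 - 2 * lam)"
proof -
  note C2 = C2_solutionD(1)[OF sol]
  have eq: "y'' t * y t = lam * (y' t)\<^sup>2 + g (t, y t, y' t) * y t" if "t \<in> {-\<tau>..\<tau>}" for t
    by (rule C2_solution_everywhere[OF sol \<tau> g that])
  \<comment> \<open>At \<open>t = 0\<close> the cleared equation reduces to
    \<open>0 = lam * (y' 0)^2\<close>.\<close>
  show y'0: "y' 0 = 0" using eq[of 0] \<tau> y0 lam by simp
  have der: "(y has_real_derivative y' t) (at t)" "(y' has_real_derivative y'' t) (at t)"
    if "t \<in> {-\<tau><..<\<tau>}" for t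
    using C2_onD(1,2)[OF C2, of t] that at_within_Icc_at[of "-\<tau>" t \<tau>] by auto
  have "\<exists>\<xi>\<in>{t<..<0}. y'' t = 2 * lam * y'' \<xi> + g (t, y t, y' t)" if t: "t \<in> {-\<delta><..<0}" for t
  proof -
    have in\<tau>: "z \<in> {-\<tau><..<\<tau>}" if "t \<le> z" "z \<le> 0" for z using that t \<delta> \<tau> by auto
    \<comment> \<open>Since \<open>y'\<close> does not vanish on the left, neither does
      \<open>y\<close>, and the equation may be divided by \<open>y t\<close> below.\<close>
    obtain z where z: "t < z" "z < 0" "y 0 - y t = (0 - t) * y' z"
      using MVT2[of t 0 y y'] der(1)[OF in\<tau>] t by auto
    then have yt: "y t \<noteq> 0" using y0 t \<delta>(3)[of z] by auto
    have "\<exists>c. t < c \<and> c < 0 \<and> ((y' 0)\<^sup>2 - (y' t)\<^sup>2) * y' c = (y 0 - y t) * (2 * y' c * y'' c)"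
    proof (rule GMVT')
      show "t < 0" using t by simp
      show "isCont (\<lambda>z. (y' z)\<^sup>2) z" if "t \<le> z" "z \<le> 0" for z
        using der(2)[OF in\<tau>[OF that]] by (intro continuous_intros DERIV_isCont)
      show "isCont y z" if "t \<le> z" "z \<le> 0" for z
        using der(1)[OF in\<tau>[OF that]] by (rule DERIV_isCont)
      show "(y has_real_derivative y' z) (at z)" if "t < z" "z < 0" for z
        using der(1)[OF in\<tau>] that by simp
      show "((\<lambda>z. (y' z)\<^sup>2) has_real_derivative 2 * y' z * y'' z) (at z)" if "t < z" "z < 0" for z
        using der(2)[OF in\<tau>, of z] that by (auto intro!: derivative_eq_intros)
    qed
    then obtain c where c: "t < c" "c < 0" "(y' t)\<^sup>2 * y' c = y t * (2 * y' c * y'' c)"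
      using y0 y'0 by auto
    have "y' c \<noteq> 0" using c t \<delta>(3)[of c] by auto
    then have "(y' t)\<^sup>2 = y t * (2 * y'' c)" using c(3) by simp
    then have "y'' t * y t = (2 * lam * y'' c + g (t, y t, y' t)) * y t"
      using eq[of t] in\<tau>[of t] t by (auto simp: algebra_simps)
    then show ?thesis using yt c by auto
  qed
  then obtain \<xi> where \<xi>: "\<And>t. t \<in> {-\<delta><..<0} \<Longrightarrow> \<xi> t \<in> {t<..<0}"
      "\<And>t. t \<in> {-\<delta><..<0} \<Longrightarrow> y'' t = 2 * lam * y'' (\<xi> t) + g (t, y t, y' t)"
    by metis
  \<comment> \<open>The intermediate point is only chosen for each \<open>t\<close> separately, so
    the limit is taken along a sequence and squeezed between \<open>T n\<close> and 0. The shift by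
    2 keeps every \<open>T n\<close> strictly above \<open>- \<delta>\<close>.\<close>
  define T where "T n = - \<delta> / real (n + 2)" for n
  have T: "T n \<in> {-\<delta><..<0}" for n
    using \<delta> add_pos_nonneg[OF \<delta>(1), of "\<delta> * real n"] by (simp add: T_def field_simps)
  have "(\<lambda>n. - \<delta> / real n) \<longlonglongrightarrow> 0" by (rule lim_const_over_n)
  then have T0: "T \<longlonglongrightarrow> 0"
    unfolding T_def[abs_def] by (rule LIMSEQ_ignore_initial_segment)
  have \<xi>0: "(\<lambda>n. \<xi> (T n)) \<longlonglongrightarrow> 0"
    by (rule tendsto_sandwich[OF _ _ T0 tendsto_const]) (use \<xi>(1)[OF T] in \<open>auto intro!: always_eventually less_imp_le\<close>)
  have mem: "T n \<in> {-\<tau>..\<tau>}" "\<xi> (T n) \<in> {-\<tau>..\<tau>}" for n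
    using T[of n] \<xi>(1)[OF T[of n]] \<delta> \<tau> by auto
  note lim = continuous_on_tendsto_compose[where s = "{-\<tau>..\<tau>}" and l = 0, OF _ T0]
  have 1: "(\<lambda>n. y'' (T n)) \<longlonglongrightarrow> y'' 0" "(\<lambda>n. y (T n)) \<longlonglongrightarrow> y 0" "(\<lambda>n. y' (T n)) \<longlonglongrightarrow> y' 0"
    using C2_onD(3-5)[OF C2] mem \<tau> by (auto intro!: lim)
  have 2: "(\<lambda>n. y'' (\<xi> (T n))) \<longlonglongrightarrow> y'' 0"
    by (rule continuous_on_tendsto_compose[OF C2_onD(5)[OF C2] \<xi>0]) (use mem \<tau> in auto)
  have "(\<lambda>n. g (T n, y (T n), y' (T n))) \<longlonglongrightarrow> g (0, y 0, y' 0)"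
    by (rule continuous_on_tendsto_compose[OF g])
       (use C2_solutionD(2)[OF sol] mem \<tau> in \<open>auto intro!: tendsto_intros 1 T0\<close>)
  then have "(\<lambda>n. 2 * lam * y'' (\<xi> (T n)) + g (T n, y (T n), y' (T n))) \<longlonglongrightarrow> 2 * lam * y'' 0 + g (0, y 0, y' 0)"
    by (intro tendsto_intros 2)
  then have "(\<lambda>n. y'' (T n)) \<longlonglongrightarrow> 2 * lam * y'' 0 + g (0, y 0, y' 0)"
    using \<xi>(2)[OF T] by simp
  from LIMSEQ_unique[OF 1(1) this] have "y'' 0 = 2 * lam * y'' 0 + g (0, 0, 0)"
    by (simp only: y0 y'0)
  moreover have "y'' 0 * (1 - 2 * lam) = y'' 0 - 2 * lam * y'' 0" by (simp add: algebra_simps)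
  ultimately have "y'' 0 * (1 - 2 * lam) = g (0, 0, 0)" by linarith
  then show "y'' 0 = g (0, 0, 0) / (1 - 2 * lam)"
    using lam(2) by (intro eq_divide_imp) auto
qed

section \<open>Twice differentiable functions and their averages\<close>

text \<open>This is Taylor's formula with integral remainder, pulled back to \<open>{0..1}\<close>
  by \<open>s * t\<close>, which treats both signs of \<open>t\<close> and the one-sided end points
  uniformly.\<close>

lemma C2_on_taylor:
  assumes C2: "C2_on {-\<tau>..\<tau>} y y' y''" and y0: "y 0 = 0" "y' 0 = 0" and t: "\<bar>t\<bar> \<le> \<tau>"
  shows "y' t = t * mean1 y'' t" "y t = t\<^sup>2 * mean2 y'' t"
proof -
  have sub: "(\<lambda>s. s * t) ` {0..1} \<subseteq> {-\<tau>..\<tau>}"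
    using scaleR_in_cball_0[of t \<tau>] t by (fastforce simp: abs_le_iff)
  have der: "((\<lambda>s. y' (s * t)) has_real_derivative y'' (s * t) * t) (at s within {0..1})"
    "((\<lambda>s. y (s * t)) has_real_derivative y' (s * t) * t) (at s within {0..1})" if s: "s \<in> {0..1}" for s
  proof -
    have m: "((\<lambda>s. s * t) has_real_derivative t) (at s within {0..1})"
      by (auto intro!: derivative_eq_intros)
    have "s * t \<in> {-\<tau>..\<tau>}" using sub s by blast
    note d = DERIV_subset[OF C2_onD(1)[OF C2 this] sub] DERIV_subset[OF C2_onD(2)[OF C2 this] sub]
    show "((\<lambda>s. y' (s * t)) has_real_derivative y'' (s * t) * t) (at s within {0..1})"
      using DERIV_image_chain[OF d(2) m] by (simp add: o_def)
    show "((\<lambda>s. y (s * t)) has_real_derivative y' (s * t) * t) (at s within {0..1})"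
      using DERIV_image_chain[OF d(1) m] by (simp add: o_def)
  qed
  have "((\<lambda>s. y'' (s * t) * t) has_integral y' (1 * t) - y' (0 * t)) {0..1}"
    using der(1) by (intro fundamental_theorem_of_calculus) (auto simp: has_real_derivative_iff_has_vector_derivative[symmetric])
  from integral_unique[OF this] have "integral {0..1} (\<lambda>s. y'' (s * t) * t) = y' t"
    by (simp only: y0 mult_1 mult_zero_left diff_zero)
  then show "y' t = t * mean1 y'' t" by (simp add: wavg_def mult.commute)
  \<comment> \<open>The antiderivative \<open>(1 - s) * t * y' (s * t) + y (s * t)\<close> comes
    from integration by parts; it vanishes at \<open>s = 0\<close> and equals \<open>y t\<close> at
    \<open>s = 1\<close>.\<close>
  have "((\<lambda>s. (1 - s) * y'' (s * t) * t\<^sup>2) has_integral 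
      ((1 - 1) * t * y' (1 * t) + y (1 * t)) - ((1 - 0) * t * y' (0 * t) + y (0 * t))) {0..1}"
  proof (rule fundamental_theorem_of_calculus[where f = "\<lambda>s. (1 - s) * t * y' (s * t) + y (s * t)"])
    fix s :: real assume s: "s \<in> {0..1}"
    have m: "((\<lambda>s. (1 - s) * t) has_real_derivative - t) (at s within {0..1})"
      by (auto intro!: derivative_eq_intros)
    have "((\<lambda>s. (1 - s) * t * y' (s * t) + y (s * t)) has_real_derivative
        (- t) * y' (s * t) + y'' (s * t) * t * ((1 - s) * t) + y' (s * t) * t) (at s within {0..1})"
      by (rule DERIV_add[OF DERIV_mult[OF m der(1)[OF s]] der(2)[OF s]])
    also have "(- t) * y' (s * t) + y'' (s * t) * t * ((1 - s) * t) + y' (s * t) * t = (1 - s) * y'' (s * t) * t\<^sup>2"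
      by (simp add: power2_eq_square)
    finally show "((\<lambda>s. (1 - s) * t * y' (s * t) + y (s * t)) has_vector_derivative
        (1 - s) * y'' (s * t) * t\<^sup>2) (at s within {0..1})"
      by (simp only: has_real_derivative_iff_has_vector_derivative)
  qed simp
  from integral_unique[OF this] have "integral {0..1} (\<lambda>s. (1 - s) * y'' (s * t) * t\<^sup>2) = y t"
    by (simp only: y0 mult_1 mult_zero_left mult_zero_right diff_zero diff_self add_0)
  then show "y t = t\<^sup>2 * mean2 y'' t" by (simp add: wavg_def mult.commute)
qed

lemma C2_on_means:
  fixes w :: "real \<Rightarrow> real"
  assumes w: "continuous_on {-\<tau>..\<tau>} w" and \<tau>: "0 < \<tau>"
  shows "C2_on {-\<tau>..\<tau>} (\<lambda>t. t\<^sup>2 * mean2 w t) (\<lambda>t. t * mean1 w t) w"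
proof -
  obtain p where p: "\<And>t. t \<in> {-\<tau>..\<tau>} \<Longrightarrow> (p has_real_derivative w t) (at t within {-\<tau>..\<tau>})"
    using antiderivative_continuous[OF w] unfolding has_real_derivative_iff_has_vector_derivative by blast
  have "continuous_on {-\<tau>..\<tau>} (\<lambda>t. p t - p 0)"
    using p by (intro continuous_intros DERIV_continuous_on)
  then obtain q where q: "\<And>t. t \<in> {-\<tau>..\<tau>} \<Longrightarrow> (q has_real_derivative p t - p 0) (at t within {-\<tau>..\<tau>})"
    using antiderivative_continuous unfolding has_real_derivative_iff_has_vector_derivative by blast
  have C2: "C2_on {-\<tau>..\<tau>} (\<lambda>t. q t - q 0) (\<lambda>t. p t - p 0) w"
    unfolding C2_on_def using p q w by (auto intro!: derivative_eq_intros)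
  have tay: "p t - p 0 = t * mean1 w t" "q t - q 0 = t\<^sup>2 * mean2 w t" if "t \<in> {-\<tau>..\<tau>}" for t
    using C2_on_taylor[OF C2, of t] that by (auto simp: abs_le_iff)
  have "((\<lambda>t. t * mean1 w t) has_real_derivative w t) (at t within {-\<tau>..\<tau>})"
    "((\<lambda>t. t\<^sup>2 * mean2 w t) has_real_derivative t * mean1 w t) (at t within {-\<tau>..\<tau>})"
    if t: "t \<in> {-\<tau>..\<tau>}" for t
  proof -
    show "((\<lambda>t. t * mean1 w t) has_real_derivative w t) (at t within {-\<tau>..\<tau>})"
      by (rule has_field_derivative_transform_within[OF C2_onD(2)[OF C2 t] zero_less_one t tay(1)])
    have "((\<lambda>t. q t - q 0) has_real_derivative t * mean1 w t) (at t within {-\<tau>..\<tau>})"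
      using C2_onD(1)[OF C2 t] tay(1)[OF t] by simp
    then show "((\<lambda>t. t\<^sup>2 * mean2 w t) has_real_derivative t * mean1 w t) (at t within {-\<tau>..\<tau>})"
      by (rule has_field_derivative_transform_within[OF _ zero_less_one t tay(2)])
  qed
  then show ?thesis using w by (simp add: C2_on_def)
qed

section \<open>Real solutions as fixed points\<close>

locale real_singular_ode = singular_ode lam a g r \<tau> \<rho> L
  for lam a :: real and g r \<tau> \<rho> L +
  fixes U :: "(real \<times> real \<times> real) set"
  assumes box: "cball 0 \<rho> \<times> cball 0 \<rho> \<times> cball 0 \<rho> \<subseteq> U"
    and g_cont: "continuous_on U g"
    and lam0: "lam \<noteq> 0"
    and a_eq: "a = g (0, 0, 0) / (1 - 2 * lam)"
begin

lemma lam_half: "lam \<noteq> 1 / 2"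
  using lam by auto

lemma means_at_0: "mean1 w 0 = w (0 :: real)" "mean2 w 0 = w (0 :: real) / 2"
  using wavg_const[OF weight_integrals(1), of "w 0" 0] wavg_const[OF weight_integrals(3), of "w 0" 0]
  by (simp_all add: wavg_def)

lemma near_curve_in_U:
  assumes "near s w" "\<bar>t\<bar> \<le> s" "s \<le> \<tau>"
  shows "(t, t\<^sup>2 * mean2 w t, t * mean1 w t) \<in> U"
  using near_box[of s w t] assms box by auto

lemma near_mean1_nonzero:
  assumes "near s w" "\<bar>t\<bar> \<le> s"
  shows "mean1 w t \<noteq> 0"
  using near_means(1)[of s w t] assms r a by auto

lemma C2_solution_sol:
  "C2_solution lam g U \<tau> (\<lambda>t. t\<^sup>2 * mean2 sol t) (\<lambda>t. t * mean1 sol t) sol"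
  unfolding C2_solution_def
proof (intro conjI ballI)
  have "continuous_on {-\<tau>..\<tau>} sol"
    using near_sol by (simp add: near_def cball_eq_atLeastAtMost)
  then show "C2_on {-\<tau>..\<tau>} (\<lambda>t. t\<^sup>2 * mean2 sol t) (\<lambda>t. t * mean1 sol t) sol"
    using \<tau>(1) by (rule C2_on_means)
  show "(t, t\<^sup>2 * mean2 sol t, t * mean1 sol t) \<in> U" if "t \<in> {-\<tau>..\<tau>}" for t
    by (rule near_curve_in_U[OF near_sol]) (use that in auto)
  have eq: "t\<^sup>2 * mean2 sol t \<noteq> 0 \<and> sol t = lam * ((t * mean1 sol t)\<^sup>2 / (t\<^sup>2 * mean2 sol t)) +
      g (t, t\<^sup>2 * mean2 sol t, t * mean1 sol t)" if "t \<in> {-\<tau>..\<tau>}" "t \<noteq> 0" for t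
  proof -
    have t: "norm t \<le> \<tau>" using that by auto
    show ?thesis
      using F_sol[OF t] near_mean2_nonzero[OF near_sol t] that by (simp add: F_def power_mult_distrib)
  qed
  have "AE t in lebesgue. t \<noteq> (0::real)"
    by (rule AE_I[where N = "{0}"]) (auto)
  then have "AE t in lebesgue. t \<in> {-\<tau>..\<tau>} \<longrightarrow> t\<^sup>2 * mean2 sol t \<noteq> 0 \<and>
      sol t = lam * ((t * mean1 sol t)\<^sup>2 / (t\<^sup>2 * mean2 sol t)) + g (t, t\<^sup>2 * mean2 sol t, t * mean1 sol t)"
    by (rule AE_mp) (intro AE_I2 impI eq)
  then show "AE t in lebesgue_on {-\<tau>..\<tau>}. t\<^sup>2 * mean2 sol t \<noteq> 0 \<and>
      sol t = lam * ((t * mean1 sol t)\<^sup>2 / (t\<^sup>2 * mean2 sol t)) + g (t, t\<^sup>2 * mean2 sol t, t * mean1 sol t)"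
    by (subst AE_restrict_space_iff) (simp, assumption)
qed

lemma sol_0: "sol 0 = a"
proof -
  have s0: "sol 0 \<noteq> 0" using near_mean1_nonzero[OF near_sol, of 0] \<tau> by (simp add: means_at_0)
  \<comment> \<open>At 0 the averages are \<open>sol 0\<close> and half of it, so the quotient is
    \<open>2 * sol 0\<close> and the fixed point equation becomes linear.\<close>
  have "F sol 0 = sol 0" using \<tau> by (intro F_sol) auto
  then have "lam * (2 * sol 0) + g (0, 0, 0) = sol 0"
    using s0 by (simp add: F_def means_at_0 power2_eq_square field_simps)
  then show ?thesis using lam_half by (simp add: a_eq field_simps)
qed

text \<open>For \<open>t \<noteq> 0\<close>, closeness to \<open>a\<close> makes \<open>y t\<close>
  nonzero, so the cleared equation can be divided and the powers of \<open>t\<close> cancel. At 0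
  the cleared equation is void, and the known value \<open>y'' 0 = a\<close> takes its
  place.\<close>

lemma solution_fixed_point:
  assumes y: "C2_solution lam g U \<tau> y y' y''" "y 0 = 0" "y' 0 = 0" "y'' 0 = a"
    and near: "near s y''" "s \<le> \<tau>" and t: "\<bar>t\<bar> \<le> s"
  shows "F y'' t = y'' t"
proof (cases "t = 0")
  case True
  have "F y'' 0 = lam * (2 * a) + g (0, 0, 0)"
    using y(4) a by (simp add: F_def means_at_0 power2_eq_square)
  also have "\<dots> = a" using lam_half by (simp add: a_eq field_simps)
  finally show ?thesis using True y(4) by simp
next
  case False
  have t': "\<bar>t\<bar> \<le> \<tau>" "t \<in> {-\<tau>..\<tau>}" using t near(2) by auto
  note tay = C2_on_taylor[OF C2_solutionD(1)[OF y(1)] y(2,3) t'(1)]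
  have m: "mean2 y'' t \<noteq> 0" using near_mean2_nonzero[OF near(1)] t by simp
  have "y'' t * y t = lam * (y' t)\<^sup>2 + g (t, y t, y' t) * y t"
    by (rule C2_solution_everywhere[OF y(1) \<tau>(1) g_cont t'(2)])
  then have "y'' t = lam * ((y' t)\<^sup>2 / y t) + g (t, y t, y' t)"
    using m False by (simp add: tay(2) field_simps)
  also have "(y' t)\<^sup>2 / y t = (mean1 y'' t)\<^sup>2 / mean2 y'' t"
    using False by (simp add: tay power_mult_distrib)
  finally show ?thesis by (simp add: F_def tay)
qed

text \<open>A first-exit argument: if \<open>y''\<close> reached distance \<open>r\<close> from
  \<open>a\<close>, take such a point \<open>t1\<close> of least modulus. On the closed ball of
  radius \<open>\<bar>t1\<bar>\<close> the function is still near \<open>a\<close> and a fixed point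
  of \<open>F\<close>, so its distance at \<open>t1\<close> is at most \<open>31 / 32 * r\<close>, a
  contradiction.\<close>

lemma solution_near:
  assumes y: "C2_solution lam g U \<tau> y y' y''" "y 0 = 0" "y' 0 = 0" "y'' 0 = a"
  shows "near \<tau> y''"
proof -
  have c: "continuous_on (cball 0 \<tau>) y''"
    using C2_onD(5)[OF C2_solutionD(1)[OF y(1)]] by (simp add: cball_eq_atLeastAtMost)
  \<comment> \<open>The weak inequality makes \<open>K\<close> closed, hence compact, so that a
    point of least modulus exists; 0 is not in \<open>K\<close> because
    \<open>y'' 0 = a\<close>.\<close>
  define K where "K = {t \<in> cball 0 \<tau>. r \<le> \<bar>y'' t - a\<bar>}"
  have "K = {}"
  proof (rule ccontr)
    assume ne: "K \<noteq> {}"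
    have "closed K"
      unfolding K_def by (rule continuous_on_closed_Collect_le) (auto intro!: continuous_intros c)
    then have "compact K"
      using compact_Int_closed[OF compact_cball, of K 0 \<tau>]
      by (simp add: Int_absorb1 K_def subset_eq)
    then obtain t1 where t1: "t1 \<in> K" "\<And>t. t \<in> K \<Longrightarrow> \<bar>t1\<bar> \<le> \<bar>t\<bar>"
      using continuous_attains_inf[OF _ ne, of abs] continuous_on_rabs[OF continuous_on_id] by blast
    define s where "s = \<bar>t1\<bar>"
    have s: "s \<le> \<tau>" "0 < s"
      using t1(1) y(4) r by (auto simp: K_def s_def)
    have lt: "\<bar>y'' u - a\<bar> \<le> r" if "u \<in> ball 0 s" for u
    proof -
      have "u \<notin> K" using t1(2)[of u] that by (auto simp: s_def)
      then show ?thesis using that s by (auto simp: K_def)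
    qed
    have "continuous_on (cball 0 s) y''"
      using c by (rule continuous_on_subset) (use s in auto)
    note cs = this
    have "\<bar>y'' u - a\<bar> \<le> r" if "u \<in> cball 0 s" for u
    \<comment> \<open>Minimality controls only the open ball; continuity extends the bound to its
      closure, which contains \<open>t1\<close>.\<close>
    proof (rule continuous_le_on_closure[where S = "ball 0 s" and f = "\<lambda>u. \<bar>y'' u - a\<bar>"])
      show "continuous_on (closure (ball 0 s)) (\<lambda>u. \<bar>y'' u - a\<bar>)"
        using s cs by (auto intro!: continuous_intros)
      show "u \<in> closure (ball 0 s)" using s that by auto
    qed (rule lt)
    with cs have "near s y''" by (simp add: near_def)
    from norm_F_diff_a[OF this _ s(1), of t1] solution_fixed_point[OF y this s(1), of t1]
    show False using t1(1) r by (simp add: s_def K_def)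
  qed
  then have "norm (y'' t - a) \<le> r" if "norm t \<le> \<tau>" for t
    using that by (simp add: K_def set_eq_iff) (meson linorder_not_less less_imp_le)
  then show ?thesis using c by (simp only: near_def) blast
qed

lemma solution_unique:
  assumes y: "C2_solution lam g U \<tau> y y' y''" "y 0 = 0"
    and \<delta>: "0 < \<delta>" "\<delta> \<le> \<tau>" "\<And>t. t \<in> {-\<delta><..<0} \<Longrightarrow> y' t \<noteq> 0"
    and t: "t \<in> {-\<tau>..\<tau>}"
  shows "y t = t\<^sup>2 * mean2 sol t"
proof -
  note init = C2_solution_initial[OF y(1) \<tau>(1) g_cont lam0 lam_half y(2) \<delta>]
  have y3: "y'' 0 = a" using init(2) a_eq by simp
  have near: "near \<tau> y''" by (rule solution_near[OF y init(1) y3])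
  have t': "\<bar>t\<bar> \<le> \<tau>" using t by auto
  have "y'' u = sol u" if "norm u \<le> \<tau>" for u
    by (rule fixed_point_unique[OF near near_sol order_refl])
       (use solution_fixed_point[OF y init(1) y3 near order_refl] F_sol that in auto)
  then have "mean2 y'' t = mean2 sol t"
    using t' by (intro wavg_cong[of t \<tau>]) auto
  then show ?thesis
    using C2_on_taylor(2)[OF C2_solutionD(1)[OF y(1)] y(2) init(1) t'] by simp
qed

end

section \<open>Lipschitz bounds and power series in three variables\<close>

text \<open>The bound is obtained for all \<open>\<tau>\<close> below a threshold, so that the real
  and the complex problem can later share one radius. The initial defect is small by continuity at
  0, where it vanishes by \<open>G0\<close>.\<close>

lemma singular_ode_for_small_tau:
  fixes lam a :: "'a::{real_normed_field,banach}"
  assumes lam: "norm lam \<le> 3 / 8" and a: "a \<noteq> 0" and \<rho>: "0 < \<rho>" and L: "0 \<le> L"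
    and G_cont: "continuous_on (cball 0 \<rho> \<times> cball 0 \<rho> \<times> cball 0 \<rho>) G"
    and G_lipschitz: "\<And>t x p y q. \<lbrakk>norm t \<le> \<rho>; norm x \<le> \<rho>; norm p \<le> \<rho>; norm y \<le> \<rho>; norm q \<le> \<rho>\<rbrakk>
      \<Longrightarrow> norm (G (t, x, p) - G (t, y, q)) \<le> L * (norm (x - y) + norm (p - q))"
    and G0: "G (0, 0, 0) = (1 - 2 * lam) * a"
  obtains \<tau>0 where "0 < \<tau>0"
    "\<And>\<tau>. 0 < \<tau> \<Longrightarrow> \<tau> \<le> \<tau>0 \<Longrightarrow> singular_ode lam a G (norm a / 100) \<tau> \<rho> L"
proof -
  define N where "N = norm a + norm a / 100"
  have N: "0 < N" "norm a \<le> N" using a by (auto simp: N_def add_pos_pos)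
  define \<tau>1 where "\<tau>1 = min 1 (min \<rho> (\<rho> / N))"
  have \<tau>1: "0 < \<tau>1" "\<tau>1 \<le> 1" "\<tau>1 \<le> \<rho>" using \<rho> N by (auto simp: \<tau>1_def)
  have \<tau>1N: "t * N \<le> \<rho>" if "t \<le> \<tau>1" for t
    using that N by (simp add: \<tau>1_def pos_le_divide_eq)
  have "continuous_on (cball 0 \<tau>1) (\<lambda>t. G (t, t\<^sup>2 * (a / 2), t * a))"
  proof (rule continuous_on_compose2[OF G_cont])
    show "(\<lambda>t. (t, t\<^sup>2 * (a / 2), t * a)) ` cball 0 \<tau>1 \<subseteq> cball 0 \<rho> \<times> cball 0 \<rho> \<times> cball 0 \<rho>"
    proof clarsimp
      fix t :: 'a assume t: "norm t \<le> \<tau>1"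
      have 1: "norm t * norm a \<le> \<rho>"
        using \<tau>1N[OF t] mult_left_mono[OF N(2), of "norm t"] by simp
      have "(norm t)\<^sup>2 * (norm a / 2) \<le> norm t * norm a"
        unfolding power2_eq_square mult.assoc
        using t \<tau>1 mult_mono[of "norm t" 1 "norm a / 2" "norm a"] by (intro mult_left_mono) auto
      then show "norm t \<le> \<rho> \<and> norm (t\<^sup>2 * a) \<le> \<rho> * 2 \<and> norm (t * a) \<le> \<rho>"
        using 1 t \<tau>1 by (simp add: norm_mult norm_power)
    qed
  qed (auto intro!: continuous_intros)
  note cont = this
  have "0 \<in> cball (0::'a) \<tau>1" "0 < norm a / 100 / 32" using \<tau>1(1) a by auto
  from cont[unfolded continuous_on_iff, rule_format, OF this]
  obtain d where d: "0 < d" "\<And>t. norm t \<le> \<tau>1 \<Longrightarrow> norm t < d \<Longrightarrow>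
      norm (G (t, t\<^sup>2 * (a / 2), t * a) - (1 - 2 * lam) * a) < norm a / 100 / 32"
    by (auto simp: dist_norm G0)
  \<comment> \<open>Halving \<open>d\<close> turns \<open>\<le>\<close> into the strict bound needed
    for continuity, and \<open>L + 1\<close> avoids dividing by zero when
    \<open>L = 0\<close>.\<close>
  define \<tau>0 where "\<tau>0 = min \<tau>1 (min (d / 2) (1 / (32 * (L + 1))))"
  have L2: "L * (2 * \<tau>) \<le> 1 / 16" if "0 < \<tau>" "\<tau> \<le> \<tau>0" for \<tau>
  proof -
    have "(L + 1) * \<tau> \<le> (L + 1) * (1 / (32 * (L + 1)))"
      using that L by (intro mult_left_mono) (auto simp: \<tau>0_def)
    also have "\<dots> = 1 / 32" using L by simp
    finally have "(L + 1) * \<tau> \<le> 1 / 32" .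
    then show ?thesis using that by (simp add: algebra_simps)
  qed
  show thesis
  proof (rule that)
    show "0 < \<tau>0" using \<tau>1 d L by (auto simp: \<tau>0_def)
    fix \<tau> assume \<tau>: "0 < \<tau>" "\<tau> \<le> \<tau>0"
    show "singular_ode lam a G (norm a / 100) \<tau> \<rho> L"
    proof
      show "norm (G (t, t\<^sup>2 * (a / 2), t * a) - (1 - 2 * lam) * a) \<le> norm a / 100 / 32" if "norm t \<le> \<tau>" for t
        using d(2)[of t] that \<tau> d(1) by (auto simp: \<tau>0_def)
      show "\<tau> * (norm a + norm a / 100) \<le> \<rho>" using \<tau>1N[of \<tau>] \<tau> by (simp add: \<tau>0_def N_def)
    qed (use lam a \<tau> \<tau>1 L L2 G_cont G_lipschitz in \<open>auto simp: \<tau>0_def\<close>)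
  qed
qed

section \<open>Lipschitz bound from continuous partial derivatives\<close>

lemma mean_value_lipschitz:
  fixes f :: "real \<Rightarrow> real"
  assumes "\<And>u. \<bar>u\<bar> \<le> \<rho> \<Longrightarrow> (f has_real_derivative f' u) (at u)" "\<And>u. \<bar>u\<bar> \<le> \<rho> \<Longrightarrow> \<bar>f' u\<bar> \<le> B"
    and "\<bar>x\<bar> \<le> \<rho>" "\<bar>y\<bar> \<le> \<rho>"
  shows "\<bar>f x - f y\<bar> \<le> B * \<bar>x - y\<bar>"
proof -
  have "norm (f x - f y) \<le> B * norm (x - y)"
    by (rule field_differentiable_bound[where S = "{-\<rho>..\<rho>}" and f' = f'])
       (use assms in \<open>auto intro: has_field_derivative_at_within\<close>)
  then show ?thesis by simp
qed

lemma lipschitz_box: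
  fixes g gx gp :: "real \<times> real \<times> real \<Rightarrow> real"
  assumes U: "open U" "(0, 0, 0) \<in> U"
    and gx: "\<And>t x p. (t, x, p) \<in> U \<Longrightarrow> ((\<lambda>u. g (t, u, p)) has_real_derivative gx (t, x, p)) (at x)"
    and gp: "\<And>t x p. (t, x, p) \<in> U \<Longrightarrow> ((\<lambda>q. g (t, x, q)) has_real_derivative gp (t, x, p)) (at p)"
    and cont: "continuous_on U gx" "continuous_on U gp"
  obtains \<rho> L where "0 < \<rho>" "0 \<le> L" "cball 0 \<rho> \<times> cball 0 \<rho> \<times> cball 0 \<rho> \<subseteq> U"
    "\<And>t x p y q. \<lbrakk>\<bar>t\<bar> \<le> \<rho>; \<bar>x\<bar> \<le> \<rho>; \<bar>p\<bar> \<le> \<rho>; \<bar>y\<bar> \<le> \<rho>; \<bar>q\<bar> \<le> \<rho>\<rbrakk>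
      \<Longrightarrow> \<bar>g (t, x, p) - g (t, y, q)\<bar> \<le> L * (\<bar>x - y\<bar> + \<bar>p - q\<bar>)"
proof -
  obtain e where e: "0 < e" "cball (0, 0, 0) e \<subseteq> U"
    using U open_contains_cball by blast
  \<comment> \<open>The norm of a triple is at most the sum of its three coordinate norms.\<close>
  define \<rho> where "\<rho> = e / 3"
  define S where "S = cball (0::real) \<rho> \<times> cball (0::real) \<rho> \<times> cball (0::real) \<rho>"
  have S: "S \<subseteq> U"
  proof
    fix z assume "z \<in> S"
    then obtain t x p where z: "z = (t, x, p)" "\<bar>t\<bar> \<le> \<rho>" "\<bar>x\<bar> \<le> \<rho>" "\<bar>p\<bar> \<le> \<rho>"
      by (auto simp: S_def)
    have "norm (t, x, p) \<le> \<bar>t\<bar> + (\<bar>x\<bar> + \<bar>p\<bar>)"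
      using norm_Pair_le[of t "(x, p)"] norm_Pair_le[of x p] by simp
    then have "norm (t, x, p) \<le> e" using z by (simp add: \<rho>_def)
    then have "z \<in> cball (0, 0, 0) e" by (simp add: z dist_norm norm_Pair)
    then show "z \<in> U" using e by blast
  qed
  have "compact S" unfolding S_def by (intro compact_Times compact_cball)
  then have "bounded (gx ` S)" "bounded (gp ` S)"
    using compact_continuous_image[OF continuous_on_subset[OF _ S]] cont compact_imp_bounded by blast+
  then obtain Bx Bp where B: "\<And>z. z \<in> S \<Longrightarrow> \<bar>gx z\<bar> \<le> Bx" "\<And>z. z \<in> S \<Longrightarrow> \<bar>gp z\<bar> \<le> Bp"
    unfolding bounded_iff by (auto simp: ball_simps)
  define L where "L = max 0 (max Bx Bp)"
  show thesis
  proof (rule that)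
    show "0 < \<rho>" "0 \<le> L" using e by (auto simp: \<rho>_def L_def)
    show "cball 0 \<rho> \<times> cball 0 \<rho> \<times> cball 0 \<rho> \<subseteq> U" using S by (simp add: S_def)
    fix t x p y q :: real
    assume a: "\<bar>t\<bar> \<le> \<rho>" "\<bar>x\<bar> \<le> \<rho>" "\<bar>p\<bar> \<le> \<rho>" "\<bar>y\<bar> \<le> \<rho>" "\<bar>q\<bar> \<le> \<rho>"
    \<comment> \<open>The passage from \<open>(t, x, p)\<close> to \<open>(t, y, q)\<close> goes
      through \<open>(t, y, p)\<close>, changing one coordinate at a time inside the box.\<close>
    have m: "(t, u, p) \<in> S" "(t, y, u) \<in> S" if "\<bar>u\<bar> \<le> \<rho>" for u
      using a that by (auto simp: S_def)
    have "\<bar>g (t, x, p) - g (t, y, p)\<bar> \<le> L * \<bar>x - y\<bar>"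
    proof (rule mean_value_lipschitz[where f = "\<lambda>u. g (t, u, p)" and f' = "\<lambda>u. gx (t, u, p)"])
      show "((\<lambda>u. g (t, u, p)) has_real_derivative gx (t, u, p)) (at u)" if "\<bar>u\<bar> \<le> \<rho>" for u
        using m(1)[OF that] S by (intro gx) blast
      show "\<bar>gx (t, u, p)\<bar> \<le> L" if "\<bar>u\<bar> \<le> \<rho>" for u
        using B(1)[OF m(1)[OF that]] by (simp add: L_def)
    qed fact+
    moreover have "\<bar>g (t, y, p) - g (t, y, q)\<bar> \<le> L * \<bar>p - q\<bar>"
    proof (rule mean_value_lipschitz[where f = "\<lambda>u. g (t, y, u)" and f' = "\<lambda>u. gp (t, y, u)"])
      show "((\<lambda>u. g (t, y, u)) has_real_derivative gp (t, y, u)) (at u)" if "\<bar>u\<bar> \<le> \<rho>" for u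
        using m(2)[OF that] S by (intro gp) blast
      show "\<bar>gp (t, y, u)\<bar> \<le> L" if "\<bar>u\<bar> \<le> \<rho>" for u
        using B(2)[OF m(2)[OF that]] by (simp add: L_def)
    qed fact+
    ultimately show "\<bar>g (t, x, p) - g (t, y, q)\<bar> \<le> L * (\<bar>x - y\<bar> + \<bar>p - q\<bar>)"
      by (simp add: distrib_left)
  qed
qed

section \<open>Complex power series in three variables\<close>

text \<open>After rescaling to the unit ball the Lipschitz constant of the power is
  \<open>n\<close>. It is absorbed by \<open>n < 2 ^ n\<close>, that is, by doubling the radius;
  this is why \<open>power_series3\<close> asks for summability at
  \<open>2 * \<rho>\<close>.\<close>

lemma norm_power_diff_le:
  fixes x y :: "'a::real_normed_field"
  assumes \<rho>: "0 < \<rho>" and x: "norm x \<le> \<rho>" and y: "norm y \<le> \<rho>"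
  shows "norm (x ^ n - y ^ n) \<le> (2 * \<rho>) ^ n * (norm (x - y) / \<rho>)"
proof -
  define u where "u = x / of_real \<rho>"
  define v where "v = y / of_real \<rho>"
  have u: "norm u \<le> 1" "norm v \<le> 1" and xy: "x = of_real \<rho> * u" "y = of_real \<rho> * v"
    using assms by (auto simp: u_def v_def norm_divide)
  have uv: "norm (u - v) = norm (x - y) / \<rho>"
    using \<rho> by (simp add: u_def v_def diff_divide_distrib[symmetric] norm_divide)
  have "x ^ n - y ^ n = of_real (\<rho> ^ n) * (u ^ n - v ^ n)"
    by (simp only: xy power_mult_distrib right_diff_distrib of_real_power)
  then have "norm (x ^ n - y ^ n) = \<rho> ^ n * norm (u ^ n - v ^ n)"
    using \<rho> by (simp only: norm_mult norm_of_real) simp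
  also have "\<dots> \<le> \<rho> ^ n * (2 ^ n * norm (u - v))"
    using norm_power_diff[OF u, of n] \<rho> of_nat_less_two_power[of n, where 'a = real]
      mult_right_mono[of "real n" "2 ^ n" "norm (u - v)"]
    by (intro mult_left_mono) auto
  finally show ?thesis by (simp add: uv power_mult_distrib mult_ac)
qed

locale power_series3 =
  fixes c :: "nat \<Rightarrow> nat \<Rightarrow> nat \<Rightarrow> real" and \<rho> :: real
  assumes \<rho>: "0 < \<rho>"
    and summable: "(\<lambda>(i, j, m). c i j m * (2 * \<rho>) ^ i * (2 * \<rho>) ^ j * (2 * \<rho>) ^ m) summable_on UNIV"
begin

definition G :: "complex \<times> complex \<times> complex \<Rightarrow> complex" where
  "G = (\<lambda>(z, x, p). \<Sum>\<^sub>\<infinity>(i, j, m)\<in>UNIV. of_real (c i j m) * z ^ i * x ^ j * p ^ m)"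

definition M :: "nat \<times> nat \<times> nat \<Rightarrow> real" where
  "M = (\<lambda>(i, j, m). \<bar>c i j m\<bar> * (2 * \<rho>) ^ i * (2 * \<rho>) ^ j * (2 * \<rho>) ^ m)"

abbreviation box :: "(complex \<times> complex \<times> complex) set" where
  "box \<equiv> cball 0 \<rho> \<times> cball 0 \<rho> \<times> cball 0 \<rho>"

lemma M_nonneg: "0 \<le> M k"
  using \<rho> by (auto simp: M_def split: prod.split)

text \<open>Unconditional summability of reals is absolute, so convergence at the single corner
  point \<open>(2 * \<rho>, 2 * \<rho>, 2 * \<rho>)\<close> provides a majorant for the whole
  complex box.\<close>

lemma summable_M: "M summable_on UNIV"
proof -
  have "M = (\<lambda>k. norm ((\<lambda>(i, j, m). c i j m * (2 * \<rho>) ^ i * (2 * \<rho>) ^ j * (2 * \<rho>) ^ m) k))"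
    using \<rho> by (auto simp: M_def fun_eq_iff abs_mult)
  then show ?thesis
    using summable unfolding summable_on_iff_abs_summable_on_real[of "\<lambda>(i, j, m). _ i j m"] by simp
qed

lemma norm_term_le:
  fixes z x p :: complex
  assumes "norm z \<le> \<rho>" "norm x \<le> \<rho>" "norm p \<le> \<rho>"
  shows "norm ((\<lambda>(i, j, m). of_real (c i j m) * z ^ i * x ^ j * p ^ m) k) \<le> M k"
proof -
  obtain i j m where k: "k = (i, j, m)" by (cases k) auto
  show ?thesis
    unfolding k M_def prod.case norm_mult norm_power norm_of_real using assms \<rho>
    by (intro mult_mono power_mono) auto
qed

lemma uniform_limit_G:
  "uniform_limit box (\<lambda>K (z, x, p). \<Sum>(i, j, m)\<in>K. of_real (c i j m) * z ^ i * x ^ j * p ^ m) G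
     (finite_subsets_at_top UNIV)"
proof -
  have "uniform_limit box (\<lambda>K y. \<Sum>k\<in>K. (\<lambda>(z, x, p). (\<lambda>(i, j, m). of_real (c i j m) * z ^ i * x ^ j * p ^ m) k) y)
     (\<lambda>y. \<Sum>\<^sub>\<infinity>k\<in>UNIV. (\<lambda>(z, x, p). (\<lambda>(i, j, m). of_real (c i j m) * z ^ i * x ^ j * p ^ m) k) y)
     (finite_subsets_at_top UNIV)"
    by (rule Weierstrass_m_test_general[OF _ summable_M]) (use norm_term_le in auto)
  then show ?thesis by (simp add: G_def split_def)
qed

lemma continuous_on_G: "continuous_on box G"
  by (rule uniform_limit_theorem[OF _ uniform_limit_G])
     (auto simp: split_def intro!: always_eventually continuous_intros)

text \<open>Stating this for a composition with functions of one variable avoids holomorphy in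
  several variables: the partial sums are polynomials in \<open>f1\<close>, \<open>f2\<close>,
  \<open>f3\<close> and converge uniformly.\<close>

lemma holomorphic_G:
  assumes f: "continuous_on (cball 0 s) f1" "continuous_on (cball 0 s) f2" "continuous_on (cball 0 s) f3"
    and h: "f1 holomorphic_on ball 0 s" "f2 holomorphic_on ball 0 s" "f3 holomorphic_on ball 0 s"
    and im: "\<And>z. z \<in> cball 0 s \<Longrightarrow> (f1 z, f2 z, f3 z) \<in> box"
  shows "(\<lambda>z. G (f1 z, f2 z, f3 z)) holomorphic_on ball 0 s"
proof -
  have lim: "uniform_limit (cball 0 s) (\<lambda>K z. \<Sum>(i, j, m)\<in>K. of_real (c i j m) * f1 z ^ i * f2 z ^ j * f3 z ^ m)
      (\<lambda>z. G (f1 z, f2 z, f3 z)) (finite_subsets_at_top UNIV)"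
    using uniform_limit_compose'[OF uniform_limit_G, of "\<lambda>z. (f1 z, f2 z, f3 z)" "cball 0 s"] im
    by auto
  have "eventually (\<lambda>K. continuous_on (cball 0 s) 
        (\<lambda>z. \<Sum>(i, j, m)\<in>K. of_real (c i j m) * f1 z ^ i * f2 z ^ j * f3 z ^ m) \<and>
      (\<lambda>z. \<Sum>(i, j, m)\<in>K. of_real (c i j m) * f1 z ^ i * f2 z ^ j * f3 z ^ m) holomorphic_on ball 0 s)
      (finite_subsets_at_top UNIV)"
    unfolding split_def
    by (intro always_eventually allI conjI continuous_intros holomorphic_intros f h)
  from holomorphic_uniform_limit[OF this lim] show ?thesis by simp
qed

lemma lipschitz_G:
  assumes z: "norm z \<le> \<rho>" and x: "norm x \<le> \<rho>" "norm y \<le> \<rho>" and p: "norm p \<le> \<rho>" "norm q \<le> \<rho>"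
  shows "norm (G (z, x, p) - G (z, y, q)) \<le> infsum M UNIV / \<rho> * (norm (x - y) + norm (p - q))"
proof -
  let ?t = "\<lambda>z x p (i, j, m). of_real (c i j m) * z ^ i * x ^ j * p ^ m :: complex"
  have hs: "(?t z x p has_sum G (z, x, p)) UNIV" if "norm z \<le> \<rho>" "norm x \<le> \<rho>" "norm p \<le> \<rho>" for z x p
    using tendsto_uniform_limitI[OF uniform_limit_G, of "(z, x, p)"] that
    by (simp add: has_sum_def split_def)
  define d where "d = (norm (x - y) + norm (p - q)) / \<rho>"
  have "norm (G (z, x, p) - G (z, y, q)) \<le> infsum M UNIV * d"
  proof (rule norm_infsum_le)
    show "((\<lambda>k. ?t z x p k - ?t z y q k) has_sum (G (z, x, p) - G (z, y, q))) UNIV"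
      using has_sum_add[OF hs[OF z x(1) p(1)] has_sum_cmult_right[OF hs[OF z x(2) p(2)], of "- 1"]] by simp
    show "((\<lambda>k. M k * d) has_sum (infsum M UNIV * d)) UNIV"
      by (intro has_sum_cmult_left has_sum_infsum summable_M)
    fix k :: "nat \<times> nat \<times> nat"
    obtain i j m where k: "k = (i, j, m)" by (cases k) auto
    let ?X = "(2 * \<rho>) ^ j" and ?P = "(2 * \<rho>) ^ m"
    have b: "norm (w ^ n) \<le> (2 * \<rho>) ^ n" if "norm w \<le> \<rho>" for w :: complex and n
      unfolding norm_power using that \<rho> by (intro power_mono) auto
    have "x ^ j * p ^ m - y ^ j * q ^ m = (x ^ j - y ^ j) * p ^ m + y ^ j * (p ^ m - q ^ m)"
      by (simp add: algebra_simps)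
    then have "norm (x ^ j * p ^ m - y ^ j * q ^ m) \<le> norm ((x ^ j - y ^ j) * p ^ m) + norm (y ^ j * (p ^ m - q ^ m))"
      by (simp only: norm_triangle_ineq)
    also have "\<dots> \<le> (?X * (norm (x - y) / \<rho>)) * ?P + ?X * (?P * (norm (p - q) / \<rho>))"
      unfolding norm_mult using \<rho>
      by (intro add_mono mult_mono norm_power_diff_le b assms) auto
    also have "\<dots> = ?X * ?P * d"
      by (simp add: d_def algebra_simps add_divide_distrib)
    finally have "norm (of_real (c i j m) * z ^ i) * norm (x ^ j * p ^ m - y ^ j * q ^ m)
        \<le> (\<bar>c i j m\<bar> * (2 * \<rho>) ^ i) * (?X * ?P * d)"
      using b[OF z, of i] \<rho> by (intro mult_mono) (auto simp: norm_mult intro!: mult_left_mono)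
    moreover have "?t z x p k - ?t z y q k = (of_real (c i j m) * z ^ i) * (x ^ j * p ^ m - y ^ j * q ^ m)"
      by (simp add: k algebra_simps)
    ultimately show "norm (?t z x p k - ?t z y q k) \<le> M k * d"
      by (simp add: k M_def norm_mult mult_ac)
  qed
  then show ?thesis by (simp add: d_def)
qed

lemma G_of_real:
  assumes "((\<lambda>(i, j, m). c i j m * t ^ i * x ^ j * p ^ m) has_sum s) UNIV"
  shows "G (of_real t, of_real x, of_real p) = of_real s"
  using infsumI[OF has_sum_of_real[OF assms, where 'a = complex]]
  by (simp add: G_def split_def)

end

section \<open>Analyticity\<close>

lemma holomorphic_on_wavg:
  fixes w :: "complex \<Rightarrow> complex"
  assumes \<phi>: "continuous_on {0..1} \<phi>" and w: "w holomorphic_on ball 0 \<tau>"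
  shows "wavg \<phi> w holomorphic_on ball 0 \<tau>"
proof -
  have mem: "s *\<^sub>R z \<in> ball 0 \<tau>" if "z \<in> ball 0 \<tau>" "s \<in> {0..1}" for z :: complex and s
    using scaleR_in_cball_0[of z "norm z" s] that by auto
  have "(\<lambda>z. integral (cbox 0 1) (\<lambda>s. \<phi> s *\<^sub>R w (s *\<^sub>R z))) holomorphic_on ball 0 \<tau>"
  proof (rule leibniz_rule_holomorphic)
    fix z :: complex and s :: real
    assume z: "z \<in> ball 0 \<tau>" and "s \<in> cbox 0 1"
    then have s: "s \<in> {0..1}" by simp
    have "(w has_field_derivative deriv w (s *\<^sub>R z)) (at (s *\<^sub>R z))"
      by (rule holomorphic_derivI[OF w open_ball mem[OF z s]])
    then have "(w has_field_derivative deriv w (s *\<^sub>R z)) (at (of_real s * z))"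
      by (simp add: scaleR_conv_of_real)
    moreover have "((\<lambda>z. of_real s * z) has_field_derivative of_real s) (at z)"
      by (auto intro!: derivative_eq_intros)
    ultimately have "((\<lambda>z. w (of_real s * z)) has_field_derivative deriv w (s *\<^sub>R z) * of_real s) (at z)"
      by (rule DERIV_chain2)
    from DERIV_cmult[OF this, of "of_real (\<phi> s)"]
    have "((\<lambda>z. of_real (\<phi> s) * w (of_real s * z)) has_field_derivative
        of_real (\<phi> s) * (deriv w (s *\<^sub>R z) * of_real s)) (at z within ball 0 \<tau>)"
      by (rule has_field_derivative_at_within)
    then show "((\<lambda>z. \<phi> s *\<^sub>R w (s *\<^sub>R z)) has_field_derivative
        of_real (\<phi> s) * (deriv w (s *\<^sub>R z) * of_real s)) (at z within ball 0 \<tau>)"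
      by (simp add: scaleR_conv_of_real)
  next
    fix z :: complex assume "z \<in> ball 0 \<tau>"
    \<comment> \<open>Integrability needs continuity on a closed ball, whereas \<open>w\<close> is
      only given on the open one; the ball through \<open>z\<close> itself suffices.\<close>
    then have "cball 0 (norm z) \<subseteq> ball 0 \<tau>" by auto
    then have "continuous_on (cball 0 (norm z)) w"
      using continuous_on_subset[OF holomorphic_on_imp_continuous_on[OF w]] by blast
    from wavg_integrable[OF \<phi> this, of z] show "(\<lambda>s. \<phi> s *\<^sub>R w (s *\<^sub>R z)) integrable_on cbox 0 1"
      by simp
  next
    have "deriv w holomorphic_on ball 0 \<tau>" by (rule holomorphic_deriv[OF w]) simp
    note dc = holomorphic_on_imp_continuous_on[OF this]
    show "continuous_on (ball 0 \<tau> \<times> cbox 0 1) (\<lambda>(z, s). of_real (\<phi> s) * (deriv w (s *\<^sub>R z) * of_real s))"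
      unfolding split_def
      by (intro continuous_intros continuous_on_compose2[OF \<phi>] continuous_on_compose2[OF dc])
         (use mem in \<open>auto simp del: mem_ball\<close>)
  qed simp
  then show ?thesis by (simp add: wavg_def[abs_def])
qed

lemma wavg_of_real:
  fixes w :: "real \<Rightarrow> real" and v :: "complex \<Rightarrow> complex"
  assumes \<phi>: "continuous_on {0..1} \<phi>" and w: "continuous_on (cball 0 \<tau>) w" and t: "\<bar>t\<bar> \<le> \<tau>"
    and v: "\<And>u. \<bar>u\<bar> \<le> \<tau> \<Longrightarrow> v (of_real u) = of_real (w u)"
  shows "wavg \<phi> v (of_real t) = of_real (wavg \<phi> w t)"
proof -
  have "((\<lambda>s. of_real (\<phi> s *\<^sub>R w (s *\<^sub>R t)) :: complex) has_integral of_real (wavg \<phi> w t)) {0..1}"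
    unfolding wavg_def
    by (intro has_integral_of_real integrable_integral wavg_integrable[OF \<phi> w]) (use t in auto)
  moreover have "of_real (\<phi> s *\<^sub>R w (s *\<^sub>R t)) = \<phi> s *\<^sub>R v (s *\<^sub>R of_real t)" if "s \<in> {0..1}" for s
  proof -
    have "v (of_real (s * t)) = of_real (w (s * t))"
      using scaleR_in_cball_0[of t \<tau> s] t that by (intro v) auto
    then show ?thesis by (simp add: scaleR_conv_of_real)
  qed
  ultimately have "((\<lambda>s. \<phi> s *\<^sub>R v (s *\<^sub>R of_real t)) has_integral of_real (wavg \<phi> w t)) {0..1}"
    by (rule has_integral_eq[rotated]) simp
  then show ?thesis by (simp add: wavg_def integral_unique)
qed

text \<open>Around every point of \<open>{-\<sigma>..\<sigma>}\<close> the disc of radius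
  \<open>\<tau> - \<sigma>\<close> lies in the domain of \<open>f\<close>, whose Taylor series
  converges there.\<close>

lemma real_analytic_on_if_holomorphic_extension:
  assumes f: "f holomorphic_on ball 0 \<tau>" and x: "\<And>t. \<bar>t\<bar> < \<tau> \<Longrightarrow> f (of_real t) = of_real (x t)"
    and \<sigma>: "\<sigma> < \<tau>"
  shows "real_analytic_on x {-\<sigma>..\<sigma>}"
  unfolding real_analytic_on_def
proof
  fix s assume s: "s \<in> {-\<sigma>..\<sigma>}"
  define e where "e = \<tau> - \<sigma>"
  have "ball (complex_of_real s) e \<subseteq> ball 0 \<tau>"
  proof
    fix z assume "z \<in> ball (complex_of_real s) e"
    then show "z \<in> ball 0 \<tau>"
      using norm_triangle_sub[of z "of_real s"] s by (auto simp: dist_norm e_def norm_minus_commute)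
  qed
  then have fs: "f holomorphic_on ball (of_real s) e"
    using f holomorphic_on_subset by blast
  \<comment> \<open>As \<open>t - s\<close> is real, taking real parts of the coefficients commutes
    with summation; their being real need not be shown.\<close>
  define c where "c n = Re ((deriv ^^ n) f (of_real s) / fact n)" for n
  have "(\<lambda>n. c n * (t - s) ^ n) sums x t" if t: "t \<in> {-\<sigma>..\<sigma>}" "\<bar>t - s\<bar> < e" for t
  proof -
    have "complex_of_real t \<in> ball (of_real s) e"
      using t(2) by (simp add: dist_norm abs_minus_commute flip: of_real_diff)
    from sums_Re[OF holomorphic_power_series[OF fs this]]
    have "(\<lambda>n. Re ((deriv ^^ n) f (of_real s) / fact n * of_real ((t - s) ^ n))) sums Re (f (of_real t))"
      by simp
    moreover have "Re (f (of_real t)) = x t" using x[of t] t(1) \<sigma> by auto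
    moreover have "Re (z * of_real u) = Re z * u" for z u by simp
    ultimately show ?thesis by (simp only: c_def)
  qed
  moreover have "0 < e" using \<sigma> by (simp add: e_def)
  ultimately show "\<exists>c. \<exists>r>0. \<forall>t\<in>{-\<sigma>..\<sigma>}. \<bar>t - s\<bar> < r \<longrightarrow> (\<lambda>n. c n * (t - s) ^ n) sums x t"
    by blast
qed

text \<open>Both problems share \<open>r\<close> and \<open>\<tau>\<close>, so that real and complex
  iterates can be compared on the same radius; the boxes and Lipschitz constants come from different
  sources and may differ.\<close>

locale complexified_ode = R: singular_ode lam a g r \<tau> \<rho> L +
  C: singular_ode "complex_of_real lam" "complex_of_real a" G r \<tau> \<rho>' L'
  for lam a :: real and g r \<tau> \<rho> L and G :: "complex \<times> complex \<times> complex \<Rightarrow> complex" and \<rho>' L' +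
  assumes G_of_real: "\<And>t x p. \<lbrakk>\<bar>t\<bar> \<le> \<rho>'; \<bar>x\<bar> \<le> \<rho>'; \<bar>p\<bar> \<le> \<rho>'\<rbrakk>
      \<Longrightarrow> G (of_real t, of_real x, of_real p) = of_real (g (t, x, p))"
    and G_holomorphic: "\<And>f1 f2 f3. \<lbrakk>continuous_on (cball 0 \<tau>) f1; continuous_on (cball 0 \<tau>) f2;
        continuous_on (cball 0 \<tau>) f3; f1 holomorphic_on ball 0 \<tau>; f2 holomorphic_on ball 0 \<tau>;
        f3 holomorphic_on ball 0 \<tau>;
        \<And>z. z \<in> cball 0 \<tau> \<Longrightarrow> (f1 z, f2 z, f3 z) \<in> cball 0 \<rho>' \<times> cball 0 \<rho>' \<times> cball 0 \<rho>'\<rbrakk>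
      \<Longrightarrow> (\<lambda>z. G (f1 z, f2 z, f3 z)) holomorphic_on ball 0 \<tau>"
begin

lemma weights_continuous: "continuous_on {0..1} (\<lambda>_. 1 :: real)" "continuous_on {0..1} (\<lambda>s. 1 - s :: real)"
  by (auto intro!: continuous_intros)

lemma F_of_real:
  assumes v: "C.near \<tau> v" and w: "R.near \<tau> w" and vw: "\<And>u. \<bar>u\<bar> \<le> \<tau> \<Longrightarrow> v (of_real u) = of_real (w u)"
    and t: "\<bar>t\<bar> \<le> \<tau>"
  shows "C.F v (of_real t) = of_real (R.F w t)"
proof -
  have w': "continuous_on (cball 0 \<tau>) w" using w by (simp add: R.near_def)
  have m: "mean1 v (of_real t) = of_real (mean1 w t)" "mean2 v (of_real t) = of_real (mean2 w t)"
    by (intro wavg_of_real[OF _ w' t vw] weights_continuous; assumption)+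
  have t': "norm (complex_of_real t) \<le> \<tau>" using t by simp
  have "\<bar>t\<bar> \<le> \<rho>'" "\<bar>t\<^sup>2 * mean2 w t\<bar> \<le> \<rho>'" "\<bar>t * mean1 w t\<bar> \<le> \<rho>'"
    using C.near_box[OF v t' order_refl] unfolding m
    by (simp_all add: norm_mult norm_power abs_mult)
  from G_of_real[OF this] show ?thesis
    by (simp add: C.F_def R.F_def m)
qed

lemma holomorphic_F:
  assumes v: "C.near \<tau> v" "v holomorphic_on ball 0 \<tau>"
  shows "C.F v holomorphic_on ball 0 \<tau>"
proof -
  have c: "continuous_on (cball 0 \<tau>) v" using v by (simp add: C.near_def)
  note cm = continuous_on_wavg[OF weights_continuous(1) c] continuous_on_wavg[OF weights_continuous(2) c]
  note hm = holomorphic_on_wavg[OF weights_continuous(1) v(2)] holomorphic_on_wavg[OF weights_continuous(2) v(2)]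
  have "(\<lambda>z. G (z, z\<^sup>2 * mean2 v z, z * mean1 v z)) holomorphic_on ball 0 \<tau>"
    by (rule G_holomorphic) (use C.near_box[OF v(1)] in \<open>auto intro!: continuous_intros holomorphic_intros cm hm\<close>)
  moreover have "mean2 v z \<noteq> 0" if "z \<in> ball 0 \<tau>" for z
    using C.near_mean2_nonzero[OF v(1)] that by simp
  ultimately show ?thesis
    unfolding C.F_def[abs_def] by (intro holomorphic_intros hm) auto
qed

lemma iter_of_real:
  assumes "\<bar>t\<bar> \<le> \<tau>"
  shows "C.iter n (of_real t) = of_real (R.iter n t)"
  using assms
proof (induction n arbitrary: t)
  case (Suc n)
  then show ?case
    using F_of_real[OF C.near_iter[of n] R.near_iter[of n]] by (simp add: C.iter_def R.iter_def)
qed (simp add: C.iter_def R.iter_def)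

lemma holomorphic_iter: "C.iter n holomorphic_on ball 0 \<tau>"
proof (induction n)
  case (Suc n)
  then show ?case
    using holomorphic_F[OF C.near_iter[of n]] by (simp add: C.iter_def)
qed (simp add: C.iter_def)

lemma holomorphic_sol: "C.sol holomorphic_on ball 0 \<tau>"
  by (rule holomorphic_uniform_limit[OF _ C.iter_uniform_limit])
     (use C.near_iter holomorphic_iter in \<open>auto simp: C.near_def\<close>)

lemma sol_of_real:
  assumes t: "\<bar>t\<bar> \<le> \<tau>"
  shows "C.sol (of_real t) = of_real (R.sol t)"
proof (rule LIMSEQ_unique)
  show "(\<lambda>n. C.iter n (of_real t)) \<longlonglongrightarrow> C.sol (of_real t)"
    using t by (intro tendsto_uniform_limitI[OF C.iter_uniform_limit]) auto
  have "(\<lambda>n. complex_of_real (R.iter n t)) \<longlonglongrightarrow> of_real (R.sol t)"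
    using t by (intro tendsto_of_real tendsto_uniform_limitI[OF R.iter_uniform_limit]) auto
  then show "(\<lambda>n. C.iter n (of_real t)) \<longlonglongrightarrow> of_real (R.sol t)"
    using iter_of_real[OF t] by simp
qed

lemma real_analytic_on_sol:
  assumes "\<sigma> < \<tau>"
  shows "real_analytic_on (\<lambda>t. t\<^sup>2 * mean2 R.sol t) {-\<sigma>..\<sigma>}"
proof (rule real_analytic_on_if_holomorphic_extension[OF _ _ assms])
  show "(\<lambda>z. z\<^sup>2 * mean2 C.sol z) holomorphic_on ball 0 \<tau>"
    by (intro holomorphic_intros holomorphic_on_wavg weights_continuous holomorphic_sol)
  have "continuous_on (cball 0 \<tau>) R.sol" using R.near_sol by (simp add: R.near_def)
  from wavg_of_real[OF weights_continuous(2) this _ sol_of_real]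
  show "(of_real t)\<^sup>2 * mean2 C.sol (of_real t) = of_real (t\<^sup>2 * mean2 R.sol t)" if "\<bar>t\<bar> < \<tau>" for t
    using that by simp
qed

end

lemma power_series3_at_0:
  assumes "real_analytic3_on g U" "(0, 0, 0) \<in> U"
  obtains c \<rho> where "power_series3 c \<rho>"
    "\<And>t x p. \<lbrakk>\<bar>t\<bar> \<le> \<rho>; \<bar>x\<bar> \<le> \<rho>; \<bar>p\<bar> \<le> \<rho>\<rbrakk> \<Longrightarrow>
      ((\<lambda>(i, j, m). c i j m * t ^ i * x ^ j * p ^ m) has_sum g (t, x, p)) UNIV"
proof -
  obtain c e where e: "0 < e" and c: "\<And>t x p. \<bar>t\<bar> < e \<Longrightarrow> \<bar>x\<bar> < e \<Longrightarrow> \<bar>p\<bar> < e \<Longrightarrow>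
      ((\<lambda>(i, j, m). c i j m * t ^ i * x ^ j * p ^ m) has_sum g (0 + t, 0 + x, 0 + p)) UNIV"
    using bspec[OF assms(1)[unfolded real_analytic3_on_def] assms(2)] unfolding prod.case by blast
  show thesis
  \<comment> \<open>The doubled radius \<open>e / 2\<close> must lie strictly inside the range
    \<open>e\<close> of the expansion.\<close>
  proof (rule that[of c "e / 4"])
    have "((\<lambda>(i, j, m). c i j m * (2 * (e / 4)) ^ i * (2 * (e / 4)) ^ j * (2 * (e / 4)) ^ m) 
        has_sum g (0 + 2 * (e / 4), 0 + 2 * (e / 4), 0 + 2 * (e / 4))) UNIV"
      using e by (intro c) auto
    then show "power_series3 c (e / 4)"
      unfolding power_series3_def using e has_sum_imp_summable by auto
  qed (use c e in auto)
qed

section \<open>Existence, uniqueness and analyticity\<close>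

lemma real_analytic_on_sol_for_small_tau:
  fixes lam a :: real and g :: "real \<times> real \<times> real \<Rightarrow> real"
  assumes real: "0 < \<tau>0" "\<And>\<tau>. 0 < \<tau> \<Longrightarrow> \<tau> \<le> \<tau>0 \<Longrightarrow> singular_ode lam a g (norm a / 100) \<tau> \<rho> L"
    and lam: "\<bar>lam\<bar> \<le> 3 / 8" and a: "a \<noteq> 0" and g0: "g (0, 0, 0) = (1 - 2 * lam) * a"
    and analytic: "real_analytic3_on g U" "(0, 0, 0) \<in> U"
  obtains \<tau>1 where "0 < \<tau>1" "\<And>\<tau>. 0 < \<tau> \<Longrightarrow> \<tau> \<le> \<tau>1 \<Longrightarrow>
      real_analytic_on (\<lambda>t. t\<^sup>2 * mean2 (singular_ode.sol lam a g) t) {-\<tau>..\<tau>}"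
proof -
  obtain c \<rho>' where "power_series3 c \<rho>'"
    and c: "\<And>t x p. \<lbrakk>\<bar>t\<bar> \<le> \<rho>'; \<bar>x\<bar> \<le> \<rho>'; \<bar>p\<bar> \<le> \<rho>'\<rbrakk> \<Longrightarrow>
      ((\<lambda>(i, j, m). c i j m * t ^ i * x ^ j * p ^ m) has_sum g (t, x, p)) UNIV"
    using power_series3_at_0[OF analytic] by blast
  then interpret P: power_series3 c \<rho>' by simp
  have G: "P.G (of_real t, of_real x, of_real p) = of_real (g (t, x, p))"
    if "\<bar>t\<bar> \<le> \<rho>'" "\<bar>x\<bar> \<le> \<rho>'" "\<bar>p\<bar> \<le> \<rho>'" for t x p
    by (rule P.G_of_real[OF c[OF that]])
  have G0: "P.G (0, 0, 0) = (1 - 2 * complex_of_real lam) * complex_of_real a"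
    using G[of 0 0 0] P.\<rho> g0 by simp
  have M: "0 \<le> infsum P.M UNIV / \<rho>'"
    using P.\<rho> by (intro divide_nonneg_pos infsum_nonneg P.M_nonneg)
  obtain \<tau>c where "0 < \<tau>c" and complex: "\<And>\<tau>. 0 < \<tau> \<Longrightarrow> \<tau> \<le> \<tau>c \<Longrightarrow>
      singular_ode (complex_of_real lam) (complex_of_real a) P.G (norm (complex_of_real a) / 100) \<tau> \<rho>' (infsum P.M UNIV / \<rho>')"
    by (rule singular_ode_for_small_tau[OF _ _ P.\<rho> M P.continuous_on_G P.lipschitz_G G0])
       (use lam a in auto)
  define \<sigma> where "\<sigma> = min \<tau>0 \<tau>c"
  have \<sigma>: "0 < \<sigma>" "\<sigma> \<le> \<tau>0" "\<sigma> \<le> \<tau>c" using real(1) \<open>0 < \<tau>c\<close> by (auto simp: \<sigma>_def)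
  interpret R: singular_ode lam a g "norm a / 100" \<sigma> \<rho> L
    by (rule real(2)[OF \<sigma>(1,2)])
  interpret C: singular_ode "complex_of_real lam" "complex_of_real a" P.G "norm a / 100" \<sigma> \<rho>' "infsum P.M UNIV / \<rho>'"
    using complex[OF \<sigma>(1,3)] by simp
  interpret complexified_ode lam a g "norm a / 100" \<sigma> \<rho> L P.G \<rho>' "infsum P.M UNIV / \<rho>'"
    by unfold_locales (use G P.holomorphic_G in auto)
  show thesis
    \<comment> \<open>Every \<open>\<tau> \<le> \<sigma> / 2\<close> is strictly below the radius
      \<open>\<sigma>\<close> of the disc, as a closed interval requires, and \<open>sol\<close> is
      the same function for all radii.\<close>
    by (rule that[of "\<sigma> / 2"]) (use \<sigma> in \<open>auto intro!: real_analytic_on_sol\<close>)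
qed

theorem theorem5:
  fixes lam :: real
    and g gx gp :: "real \<times> real \<times> real \<Rightarrow> real"
    and U :: "(real \<times> real \<times> real) set"
  assumes "0 < \<bar>lam\<bar>" and "\<bar>lam\<bar> < 3 / 8"
    and "open U" and "(0, 0, 0) \<in> U"
    and "continuous_on U g"
    and "\<And>t x p. (t, x, p) \<in> U \<Longrightarrow> ((\<lambda>u. g (t, u, p)) has_real_derivative gx (t, x, p)) (at x)"
    and "\<And>t x p. (t, x, p) \<in> U \<Longrightarrow> ((\<lambda>q. g (t, x, q)) has_real_derivative gp (t, x, p)) (at p)"
    and "continuous_on U gx" and "continuous_on U gp"
    and "g (0, 0, 0) \<noteq> 0"
  shows "\<exists>\<tau>>0. \<exists>x x' x''.
      (C2_solution lam g U \<tau> x x' x'' \<and> x 0 = 0 \<and>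
         (\<exists>\<delta>. 0 < \<delta> \<and> \<delta> \<le> \<tau> \<and> (\<forall>t\<in>{-\<delta><..<0}. x' t \<noteq> 0))) \<and>
      (\<forall>y y' y''.
         C2_solution lam g U \<tau> y y' y'' \<and> y 0 = 0 \<and>
           (\<exists>\<delta>. 0 < \<delta> \<and> \<delta> \<le> \<tau> \<and> (\<forall>t\<in>{-\<delta><..<0}. y' t \<noteq> 0)) \<longrightarrow>
         (\<forall>t\<in>{-\<tau>..\<tau>}. y t = x t)) \<and>
      x' 0 = 0 \<and> x'' 0 = g (0, 0, 0) / (1 - 2 * lam) \<and>
      (real_analytic3_on g U \<longrightarrow> real_analytic_on x {-\<tau>..\<tau>})"
proof -
  define a where "a = g (0, 0, 0) / (1 - 2 * lam)"
  have lam_bounds: "lam \<noteq> 0" "\<bar>lam\<bar> \<le> 3 / 8" "1 - 2 * lam \<noteq> 0" using assms(1,2) by auto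
  have a: "a \<noteq> 0" using assms(10) lam_bounds by (simp add: a_def)
  have g0: "g (0, 0, 0) = (1 - 2 * lam) * a" using lam_bounds by (simp add: a_def)
  obtain \<rho> L where \<rho>: "0 < \<rho>" "0 \<le> L" "cball 0 \<rho> \<times> cball 0 \<rho> \<times> cball 0 \<rho> \<subseteq> U"
    and L: "\<And>t x p y q. \<lbrakk>\<bar>t\<bar> \<le> \<rho>; \<bar>x\<bar> \<le> \<rho>; \<bar>p\<bar> \<le> \<rho>; \<bar>y\<bar> \<le> \<rho>; \<bar>q\<bar> \<le> \<rho>\<rbrakk>
      \<Longrightarrow> \<bar>g (t, x, p) - g (t, y, q)\<bar> \<le> L * (\<bar>x - y\<bar> + \<bar>p - q\<bar>)"
    using lipschitz_box[OF assms(3,4,6,7,8,9)] by blast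
  obtain \<tau>0 where \<tau>0: "0 < \<tau>0"
    and ode: "\<And>\<tau>. 0 < \<tau> \<Longrightarrow> \<tau> \<le> \<tau>0 \<Longrightarrow> singular_ode lam a g (norm a / 100) \<tau> \<rho> L"
    by (rule singular_ode_for_small_tau[OF _ a \<rho>(1,2) continuous_on_subset[OF assms(5) \<rho>(3)] _ g0])
       (use lam_bounds L in auto)
  obtain \<tau>1 where \<tau>1: "0 < \<tau>1" "\<And>\<tau>. 0 < \<tau> \<Longrightarrow> \<tau> \<le> \<tau>1 \<Longrightarrow> real_analytic3_on g U \<Longrightarrow>
      real_analytic_on (\<lambda>t. t\<^sup>2 * mean2 (singular_ode.sol lam a g) t) {-\<tau>..\<tau>}"
  \<comment> \<open>One \<open>\<tau>\<close> must be fixed before analyticity is assumed; without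
    it the claim is vacuous and any positive threshold, here 1, will do.\<close>
  proof (cases "real_analytic3_on g U")
    case True
    show ?thesis
      by (rule real_analytic_on_sol_for_small_tau[OF \<tau>0 ode lam_bounds(2) a g0 True assms(4)]) (use that in blast)+
  next
    case False
    then show ?thesis using that[of 1] by simp
  qed
  define \<tau> where "\<tau> = min \<tau>0 \<tau>1"
  have tau_bounds: "0 < \<tau>" "\<tau> \<le> \<tau>0" "\<tau> \<le> \<tau>1" using \<tau>0 \<tau>1 by (auto simp: \<tau>_def)
  interpret singular_ode lam a g "norm a / 100" \<tau> \<rho> L
    by (rule ode[OF tau_bounds(1,2)])
  interpret real_singular_ode lam a g "norm a / 100" \<tau> \<rho> L U
    by unfold_locales (use \<rho>(3) assms(5) lam_bounds(1) a_def in auto)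
  have nz: "t * mean1 sol t \<noteq> 0" if "t \<in> {-\<tau><..<0}" for t
    using near_mean1_nonzero[OF near_sol, of t] that by auto
  show ?thesis
  proof (rule exI[of _ \<tau>], rule conjI[OF \<tau>(1)], rule exI[of _ "\<lambda>t. t\<^sup>2 * mean2 sol t"],
      rule exI[of _ "\<lambda>t. t * mean1 sol t"], rule exI[of _ sol], intro conjI allI impI ballI)
    show "C2_solution lam g U \<tau> (\<lambda>t. t\<^sup>2 * mean2 sol t) (\<lambda>t. t * mean1 sol t) sol"
      by (rule C2_solution_sol)
    show "\<exists>\<delta>. 0 < \<delta> \<and> \<delta> \<le> \<tau> \<and> (\<forall>t\<in>{-\<delta><..<0}. t * mean1 sol t \<noteq> 0)"
      using \<tau>(1) nz by blast
    show "sol 0 = g (0, 0, 0) / (1 - 2 * lam)" using sol_0 by (simp add: a_def)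
    show "real_analytic_on (\<lambda>t. t\<^sup>2 * mean2 sol t) {-\<tau>..\<tau>}" if "real_analytic3_on g U"
      by (rule \<tau>1(2)[OF tau_bounds(1,3) that])
  next
    fix y y' y'' t
    assume y: "C2_solution lam g U \<tau> y y' y'' \<and> y 0 = 0 \<and>
        (\<exists>\<delta>. 0 < \<delta> \<and> \<delta> \<le> \<tau> \<and> (\<forall>t\<in>{-\<delta><..<0}. y' t \<noteq> 0))" and t: "t \<in> {-\<tau>..\<tau>}"
    then obtain \<delta> where "0 < \<delta>" "\<delta> \<le> \<tau>" "\<And>t. t \<in> {-\<delta><..<0} \<Longrightarrow> y' t \<noteq> 0" by blast
    with y t show "y t = t\<^sup>2 * mean2 sol t" using solution_unique[of y y' y'' \<delta> t] by blast
  qed auto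
qed

end
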